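(* Let $n\geq1$ be an integer and let $\epsilon>0$ be a sufficiently small constant (i.e. there is $\epsilon_0>0$ such that the following holds for every $\epsilon\in(0,\epsilon_0)$). Let $u$ be the solution of $u_{tt}-\Delta u=0$ in $(0,\infty)\times\mathbb{R}^n$, $(u,u_t)(0,\cdot)=(u_0,u_1)$, where $u_0\in L^2(\mathbb{R}^n)$ and $u_1\in L^2(\mathbb{R}^n)$ is such that, for some constant $c_0>0$, $|\hat u_1(\xi)|\geq c_0|\xi|^{-\frac n2+\frac\epsilon2}$ for $|\xi|\in(0,1]$. Then there are constants $c,C,T>0$ independent of $t$, with $C$ also independent of the data, such that $$c\,t^{1-\frac\epsilon2}\leq\|u(t,\cdot)\|_{L^2}\leq C\,t\,\big(\|u_0\|_{L^2}+\|u_1\|_{L^2}\big)\qquad\text{for all } t\geq T.$$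
   Context: $\hat f$ is the Fourier transform of $f$ on $\mathbb{R}^n$. The solution is given by $\hat u(t,\xi)=\cos(|\xi|t)\,\hat u_0(\xi)+\frac{\sin(|\xi|t)}{|\xi|}\hat u_1(\xi)$. *)

theory Defs
  imports "HOL-Analysis.Analysis"
begin

definition L2 :: "('a::euclidean_space \<Rightarrow> complex) set" where
  "L2 = {f \<in> borel_measurable lebesgue. integrable lebesgue (\<lambda>x. (norm (f x))\<^sup>2)}"

definition L2_norm :: "('a::euclidean_space \<Rightarrow> complex) \<Rightarrow> real" where
  "L2_norm f = sqrt (LINT x|lebesgue. (norm (f x))\<^sup>2)"

text \<open>The angular-frequency convention with the unitary factor \<open>(2\<pi>)\<close> to the power \<open>-n/2\<close>,
  under which \<open>-\<Delta>\<close> becomes multiplication by the square of \<open>norm \<xi>\<close>.\<close>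

definition fourier_integral :: "('a::euclidean_space \<Rightarrow> complex) \<Rightarrow> 'a \<Rightarrow> complex" where
  "fourier_integral f \<xi> =
     of_real ((2 * pi) powr (- real DIM('a) / 2)) * (LINT x|lebesgue. cis (- (x \<bullet> \<xi>)) * f x)"

text \<open>The Fourier transform on \<open>L2\<close> cannot be given by the integral, as \<open>f\<close> need not be integrable.
  It is the limit in \<open>L2\<close> of the integrals over balls of radius \<open>R \<rightarrow> \<infinity>\<close>, and so is only determined
  up to null sets; hence a relation. The limit is taken with the nonnegative integral because
  \<^const>\<open>L2_norm\<close> is meaningless (namely 0) outside \<^const>\<open>L2\<close>.\<close>

definition has_L2_fourier ::
    "('a::euclidean_space \<Rightarrow> complex) \<Rightarrow> ('a \<Rightarrow> complex) \<Rightarrow> bool" where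
  "has_L2_fourier f g \<longleftrightarrow> f \<in> L2 \<and> g \<in> L2 \<and>
     ((\<lambda>R. \<integral>\<^sup>+\<xi>. ennreal ((norm (fourier_integral (\<lambda>x. indicator (cball 0 R) x * f x) \<xi> - g \<xi>))\<^sup>2)
             \<partial>lebesgue) \<longlongrightarrow> 0) at_top"

text \<open>The value at \<open>\<xi> = 0\<close>, where division by zero yields 0, is irrelevant: it affects only a null set.\<close>

definition wave_hat ::
    "('a::euclidean_space \<Rightarrow> complex) \<Rightarrow> ('a \<Rightarrow> complex) \<Rightarrow> real \<Rightarrow> 'a \<Rightarrow> complex" where
  "wave_hat v0 v1 t \<xi> =
     of_real (cos (norm \<xi> * t)) * v0 \<xi> + of_real (sin (norm \<xi> * t) / norm \<xi>) * v1 \<xi>"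

text \<open>Sanity check: frequency by frequency, \<^const>\<open>wave_hat\<close> solves the Fourier-transformed
  Cauchy problem \<open>w'' + (norm \<xi>)\<^sup>2 w = 0\<close>, \<open>w(0) = v0 \<xi>\<close>, \<open>w'(0) = v1 \<xi>\<close>.\<close>

lemma wave_hat_solves_transformed_equation:
  fixes v0 v1 :: "'a::euclidean_space \<Rightarrow> complex"
  assumes "\<xi> \<noteq> 0"
  defines "w' \<equiv> \<lambda>t. of_real (- norm \<xi> * sin (norm \<xi> * t)) * v0 \<xi> + of_real (cos (norm \<xi> * t)) * v1 \<xi>"
  shows "wave_hat v0 v1 0 \<xi> = v0 \<xi>"
    and "w' 0 = v1 \<xi>"
    and "((\<lambda>t. wave_hat v0 v1 t \<xi>) has_vector_derivative w' t) (at t)"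
    and "(w' has_vector_derivative - of_real ((norm \<xi>)\<^sup>2) * wave_hat v0 v1 t \<xi>) (at t)"
proof -
  show "wave_hat v0 v1 0 \<xi> = v0 \<xi>" "w' 0 = v1 \<xi>"
    by (simp_all add: wave_hat_def w'_def)
  have "((\<lambda>t. cos (norm \<xi> * t)) has_real_derivative - norm \<xi> * sin (norm \<xi> * t)) (at t)"
    "((\<lambda>t. sin (norm \<xi> * t) / norm \<xi>) has_real_derivative cos (norm \<xi> * t)) (at t)"
    using assms(1) by (auto intro!: derivative_eq_intros)
  then show "((\<lambda>t. wave_hat v0 v1 t \<xi>) has_vector_derivative w' t) (at t)"
    unfolding wave_hat_def w'_def
    by (intro has_vector_derivative_add has_vector_derivative_mult_left has_vector_derivative_of_real)
  have "((\<lambda>t. - norm \<xi> * sin (norm \<xi> * t)) has_real_derivative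
      - (norm \<xi>)\<^sup>2 * cos (norm \<xi> * t)) (at t)"
    "((\<lambda>t. cos (norm \<xi> * t)) has_real_derivative
      - (norm \<xi>)\<^sup>2 * (sin (norm \<xi> * t) / norm \<xi>)) (at t)"
    using assms(1) by (auto intro!: derivative_eq_intros simp: power2_eq_square)
  then have "(w' has_vector_derivative
      of_real (- (norm \<xi>)\<^sup>2 * cos (norm \<xi> * t)) * v0 \<xi> +
      of_real (- (norm \<xi>)\<^sup>2 * (sin (norm \<xi> * t) / norm \<xi>)) * v1 \<xi>) (at t)"
    unfolding w'_def
    by (intro has_vector_derivative_add has_vector_derivative_mult_left has_vector_derivative_of_real)
  then show "(w' has_vector_derivative - of_real ((norm \<xi>)\<^sup>2) * wave_hat v0 v1 t \<xi>) (at t)"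
    by (simp add: wave_hat_def algebra_simps)
qed

text \<open>For data merely in \<^const>\<open>L2\<close>, the solution of the Cauchy problem \<open>u\<^sub>t\<^sub>t - \<Delta>u = 0\<close>,
  \<open>(u, u\<^sub>t)(0) = (u0, u1)\<close> is understood as the one given by its spatial Fourier transform.\<close>

definition wave_solution ::
    "('a::euclidean_space \<Rightarrow> complex) \<Rightarrow> ('a \<Rightarrow> complex) \<Rightarrow> (real \<Rightarrow> 'a \<Rightarrow> complex) \<Rightarrow> bool" where
  "wave_solution u0 u1 u \<longleftrightarrow>
     (\<exists>v0 v1. has_L2_fourier u0 v0 \<and> has_L2_fourier u1 v1 \<and>
        (\<forall>t\<ge>0. has_L2_fourier (u t) (wave_hat v0 v1 t)))"

end

theory Submission
  imports Defs "HOL-Probability.Characteristic_Functions"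
begin

text \<open>By Plancherel's theorem the norms of \<open>u0\<close>, \<open>u1\<close> and \<open>u(t)\<close> are those of their transforms. The
  upper bound then follows from \<open>\<bar>sin (r t) / r\<bar> \<le> t\<close>. For the lower bound it suffices to look at the ball
  \<open>norm \<xi> \<le> 1/t\<close>, of volume a constant times \<open>t\<close> to the power \<open>-n\<close>: there \<open>sin (r t) / r \<ge> t / 2\<close>
  and the transform of \<open>u1\<close> is at least \<open>c0\<close> times \<open>t\<close> to the power \<open>n/2 - \<epsilon>/2\<close>, which yields
  \<open>c t powr (1 - \<epsilon>/2)\<close>; the contribution of \<open>u0\<close> stays bounded.

  Plancherel's theorem for integrable square integrable \<open>f\<close> comes from Gaussian regularisation: the
  integral of the squared transform against \<open>exp (- (s norm \<xi>)\<^sup>2 / 2)\<close> equals the mean, over a standard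
  normal vector \<open>w\<close>, of the autocorrelation of \<open>f\<close> at \<open>s w\<close>. As \<open>s \<rightarrow> 0\<close> the left side converges
  monotonically, and the right side converges because translation is continuous in \<open>L2\<close>.\<close>

section \<open>Gaussians and translations\<close>

lemma lborel_affine_integrable:
  fixes f :: "'a::euclidean_space \<Rightarrow> 'b::{banach, second_countable_topology}"
  assumes f: "integrable lborel f" and c: "c \<noteq> 0"
  shows "integrable lborel (\<lambda>x. f (t + c *\<^sub>R x))"
proof -
  have [measurable]: "f \<in> borel_measurable borel" using f by auto
  have "integrable (density (distr lborel borel (\<lambda>x. t + c *\<^sub>R x)) (\<lambda>_. \<bar>c\<bar>^DIM('a))) f"
    using f lborel_affine[OF c, of t] by simp
  then have "integrable lborel (\<lambda>x. (\<bar>c\<bar>^DIM('a)) *\<^sub>R f (t + c *\<^sub>R x))"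
    by (subst (asm) integrable_density) (auto simp: integrable_distr_eq)
  from integrable_scaleR_right[OF this, of "inverse (\<bar>c\<bar>^DIM('a))"]
  show ?thesis using c by simp
qed

lemma lborel_affine_integral:
  fixes f :: "'a::euclidean_space \<Rightarrow> 'b::{banach, second_countable_topology}"
  assumes [measurable]: "f \<in> borel_measurable borel" and c: "c \<noteq> 0"
  shows "(LINT x|lborel. f x) = (\<bar>c\<bar>^DIM('a)) *\<^sub>R (LINT x|lborel. f (t + c *\<^sub>R x))"
  by (subst lborel_affine[OF c, of t]) (simp add: integral_density integral_distr)

lemmas lborel_translate_integrable = lborel_affine_integrable[of _ 1 "- z" for z, simplified]

lemma lborel_translate_integral:
  fixes f :: "'a::euclidean_space \<Rightarrow> 'b::{banach, second_countable_topology}"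
  assumes "f \<in> borel_measurable borel"
  shows "(LINT x|lborel. f (x - z)) = (LINT x|lborel. f x)"
  using lborel_affine_integral[OF assms, of 1 "-z"] by simp

section \<open>The standard Gaussian and its Fourier transform\<close>

text \<open>The product form lets integrals factor over the coordinates; \<open>gauss_eq\<close>
  recovers the radial form.\<close>

definition gauss :: "'a::euclidean_space \<Rightarrow> real" where
  "gauss x = (\<Prod>b\<in>Basis. std_normal_density (x \<bullet> b))"

lemma prod_exp_Basis:
  "(\<Prod>b\<in>Basis. exp (- (z \<bullet> b)\<^sup>2 / 2)) = exp (- (norm (z::'a::euclidean_space))\<^sup>2 / 2)"
proof -
  have "(norm z)\<^sup>2 = (\<Sum>b\<in>Basis. (z \<bullet> b)\<^sup>2)"
    unfolding power2_norm_eq_inner by (subst euclidean_inner) (simp add: power2_eq_square)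
  then show ?thesis
    by (simp add: exp_sum[symmetric] sum_negf sum_divide_distrib)
qed

lemma gauss_eq:
  "gauss (x::'a::euclidean_space) = (2 * pi) powr (- real DIM('a) / 2) * exp (- (norm x)\<^sup>2 / 2)"
proof -
  have "1 / sqrt (2 * pi) = (2 * pi) powr (- 1 / 2)"
    by (simp add: powr_minus powr_half_sqrt field_simps)
  then have "(1 / sqrt (2 * pi)) ^ DIM('a) = (2 * pi) powr (- real DIM('a) / 2)"
    by (simp add: powr_powr powr_realpow[symmetric])
  moreover note prod_exp_Basis[of x]
  ultimately show ?thesis
    by (simp only: gauss_def std_normal_density_def prod.distrib prod_constant)
qed

lemma gauss_pos: "gauss x > 0"
  by (simp add: gauss_eq)

lemma gauss_le: "gauss (x::'a::euclidean_space) \<le> (2 * pi) powr (- real DIM('a) / 2)"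
  by (simp add: gauss_eq)

lemma gauss_minus: "gauss (- x) = gauss x"
  by (simp add: gauss_eq)

lemma borel_measurable_gauss [measurable]: "gauss \<in> borel_measurable borel"
  unfolding gauss_eq[abs_def] by measurable

text \<open>Fubini for a product over coordinates: \<open>lborel\<close> is the image of the product
  of real Lebesgue measures indexed by \<open>Basis\<close>, and on that product the factors
  separate.\<close>

lemma
  fixes f :: "'a::euclidean_space \<Rightarrow> real \<Rightarrow> 'b::{real_normed_field, banach, second_countable_topology}"
  assumes f: "\<And>b. b \<in> Basis \<Longrightarrow> integrable lborel (f b)"
  shows integrable_lborel_prod: "integrable lborel (\<lambda>x. \<Prod>b\<in>Basis. f b (x \<bullet> b))"
    and integral_lborel_prod:
      "(LINT x|lborel. (\<Prod>b\<in>Basis. f b (x \<bullet> b))) = (\<Prod>b\<in>Basis. LINT y|lborel. f b y)"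
proof -
  interpret product_sigma_finite "\<lambda>_::'a. lborel :: real measure"
    by standard
  have meas [measurable]: "f b \<in> borel_measurable borel" if "b \<in> Basis" for b
    using f[OF that] by auto
  have comp: "(\<Prod>b\<in>Basis. f b ((\<Sum>b\<in>Basis. x b *\<^sub>R b) \<bullet> b)) = (\<Prod>b\<in>Basis. f b (x b))" for x :: "'a \<Rightarrow> real"
    by (rule prod.cong) simp_all
  have [measurable]: "(\<lambda>x. \<Prod>b\<in>Basis. f b (x \<bullet> b)) \<in> borel_measurable borel"
    by (intro borel_measurable_prod measurable_compose[OF _ meas]) auto
  show "integrable lborel (\<lambda>x. \<Prod>b\<in>Basis. f b (x \<bullet> b))"
    by (subst lborel_eq, subst integrable_distr_eq) (auto simp: comp intro!: product_integrable_prod f)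
  show "(LINT x|lborel. (\<Prod>b\<in>Basis. f b (x \<bullet> b))) = (\<Prod>b\<in>Basis. LINT y|lborel. f b y)"
    by (subst lborel_eq, subst integral_distr) (auto simp: comp intro!: product_integral_prod f)
qed

lemma integrable_gauss: "integrable lborel gauss"
  unfolding gauss_def[abs_def] by (intro integrable_lborel_prod) auto

lemma integral_gauss: "(LINT x|lborel. gauss x) = 1"
  unfolding gauss_def[abs_def] by (subst integral_lborel_prod) auto

text \<open>The integrand factors over \<open>Basis\<close>, and each factor integrates to the
  characteristic function of the standard normal distribution.\<close>

lemma gauss_fourier:
  fixes z :: "'a::euclidean_space"
  shows "(LINT w|lborel. cis (z \<bullet> w) * of_real (gauss w)) = of_real (exp (- (norm z)\<^sup>2 / 2))"
proof -
  have cis: "cis (z \<bullet> w) * of_real (gauss w) =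
      (\<Prod>b\<in>Basis. cis ((z \<bullet> b) * (w \<bullet> b)) * of_real (std_normal_density (w \<bullet> b)))" for w
    by (subst euclidean_inner)
       (simp add: gauss_def prod.distrib cis_conv_exp sum_distrib_left exp_sum of_real_sum)
  have int: "integrable lborel (\<lambda>x. cis (s * x) * of_real (std_normal_density x))" for s
    by (rule Bochner_Integration.integrable_bound[of _ std_normal_density])
       (auto simp: norm_mult cis_conv_exp)
  have "(LINT x|lborel. cis (s * x) * of_real (std_normal_density x)) = of_real (exp (- s\<^sup>2 / 2))" for s
  proof -
    have "(LINT x|lborel. cis (s * x) * of_real (std_normal_density x)) = char std_normal_distribution s"
      unfolding char_def
      by (subst integral_density) (auto simp: cis_conv_exp scaleR_conv_of_real mult_ac)
    then show ?thesis by (simp add: char_std_normal_distribution)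
  qed
  moreover note prod_exp_Basis[of z]
  ultimately show ?thesis
    unfolding cis
    by (subst integral_lborel_prod[of "\<lambda>b x. cis ((z \<bullet> b) * x) * of_real (std_normal_density x)"])
       (auto simp: int simp flip: of_real_prod)
qed

section \<open>Continuity of translation in L1 and L2\<close>

text \<open>Induction over integrable functions: indicators of sets of finite measure are compared
  with open supersets, sums follow from the triangle inequality, and dominated limits from a
  three-term estimate in which the approximation error is translation invariant.\<close>

lemma L1_translation_continuous:
  fixes f :: "'a::euclidean_space \<Rightarrow> 'b::{banach, second_countable_topology}"
  assumes "integrable lborel f" and z: "z \<longlonglongrightarrow> 0"
  shows "(\<lambda>k::nat. LINT x|lborel. norm (f (x - z k) - f x)) \<longlonglongrightarrow> 0"
  using assms(1)
proof (induction rule: integrable_induct)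
  case (base A c)
  have ind: "(\<lambda>k. LINT x|lborel. \<bar>indicator A (x - z k) - indicator A x\<bar>) \<longlonglongrightarrow> (0::real)"
  proof (rule LIMSEQ_I)
    fix e :: real assume e: "0 < e"
    have [measurable]: "A \<in> sets borel" using base by simp
    \<comment> \<open>The excess \<open>U - A\<close> will be charged twice, once in place and once
      translated, which costs e/2 and leaves e/2 for \<open>U\<close> itself.\<close>
    obtain U where U: "open U" "A \<subseteq> U" "emeasure lborel (U - A) < e / 4"
      using outer_regular_lborel[of A "e / 4"] e by auto
    have [measurable]: "U \<in> sets borel" using U by simp
    have finA: "emeasure lborel A < \<infinity>" using base by simp
    have finD: "emeasure lborel (U - A) < \<infinity>" using less_trans[OF U(3) ennreal_less_top] by simp
    have finU: "emeasure lborel U < \<infinity>"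
    proof -
      have "emeasure lborel U \<le> emeasure lborel A + emeasure lborel (U - A)"
        using emeasure_subadditive[of A lborel "U - A"] U(2) by (simp add: Un_absorb1)
      also have "\<dots> < \<infinity>" using finA finD by simp
      finally show ?thesis .
    qed
    define a u d :: "'a \<Rightarrow> real" where "a = indicator A" and "u = indicator U" and "d = indicator (U - A)"
    have iA: "integrable lborel a" and iU: "integrable lborel u" and iD: "integrable lborel d"
      unfolding a_def u_def d_def using finA finU finD by (auto intro!: integrable_real_indicator)
    note [measurable] = borel_measurable_integrable[OF iA] borel_measurable_integrable[OF iU] borel_measurable_integrable[OF iD]
    note tr = lborel_translate_integrable
    have dle: "(LINT x|lborel. d x) \<le> e / 4"
    proof -
      have "measure lborel (U - A) \<le> e / 4"
        unfolding measure_def using U(3) e by (intro enn2real_leI less_imp_le) auto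
      then show ?thesis by (simp add: d_def)
    qed
    \<comment> \<open>For open \<open>U\<close> the positive part of \<open>u x - u (x - z k)\<close> tends to 0 pointwise, and the negative part
      has the same integral, as Lebesgue measure is translation invariant.\<close>
    have pos: "(\<lambda>k. LINT x|lborel. max 0 (u x - u (x - z k))) \<longlonglongrightarrow> (LINT x::'a|lborel. 0)"
    proof (rule integral_dominated_convergence[where w = u])
      show "AE x in lborel. (\<lambda>k. max 0 (u x - u (x - z k))) \<longlonglongrightarrow> 0"
      proof (rule AE_I2)
        fix x
        show "(\<lambda>k. max 0 (u x - u (x - z k))) \<longlonglongrightarrow> 0"
        proof (cases "x \<in> U")
          case True
          have "(\<lambda>k. x - z k) \<longlonglongrightarrow> x - 0" by (intro tendsto_intros z)
          then have "eventually (\<lambda>k. x - z k \<in> U) sequentially"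
            using U(1) True by (auto simp: tendsto_def)
          then show ?thesis
            by (intro tendsto_eventually) (auto elim!: eventually_mono simp: u_def True)
        qed (simp add: u_def max_absorb1)
      qed
    qed (use iU in \<open>auto simp: u_def split: split_indicator\<close>)
    have eq: "(LINT x|lborel. \<bar>u (x - z k) - u x\<bar>) = 2 * (LINT x|lborel. max 0 (u x - u (x - z k)))" for k
    proof -
      have "(LINT x|lborel. \<bar>u (x - z k) - u x\<bar>) =
          (LINT x|lborel. 2 * max 0 (u x - u (x - z k)) + (u (x - z k) - u x))"
        by (rule Bochner_Integration.integral_cong) (auto simp: max_def)
      also have "\<dots> = 2 * (LINT x|lborel. max 0 (u x - u (x - z k))) + (LINT x|lborel. u (x - z k) - u x)"
        using iU tr[OF iU, of "z k"] by (subst Bochner_Integration.integral_add) (auto intro!: integrable_max)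
      also have "(LINT x|lborel. u (x - z k) - u x) = 0"
        using iU tr[OF iU] by (subst Bochner_Integration.integral_diff) (auto simp: lborel_translate_integral)
      finally show ?thesis by simp
    qed
    have "(\<lambda>k. LINT x|lborel. \<bar>u (x - z k) - u x\<bar>) \<longlonglongrightarrow> 0"
      unfolding eq using tendsto_mult_right[OF pos, of 2] by simp
    then have "eventually (\<lambda>k. (LINT x|lborel. \<bar>u (x - z k) - u x\<bar>) < e / 2) sequentially"
      using e by (intro order_tendstoD) auto
    then obtain N where N: "\<And>k. k \<ge> N \<Longrightarrow> (LINT x|lborel. \<bar>u (x - z k) - u x\<bar>) < e / 2"
      by (auto simp: eventually_sequentially)
    have "(LINT x|lborel. \<bar>a (x - z k) - a x\<bar>) < e" if "k \<ge> N" for k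
    proof -
      \<comment> \<open>As \<open>A\<close> lies in \<open>U\<close>, one has
        \<open>a = u - d\<close> pointwise; this is the triangle inequality applied to that
        difference.\<close>
      have "(LINT x|lborel. \<bar>a (x - z k) - a x\<bar>) \<le> (LINT x|lborel. \<bar>u (x - z k) - u x\<bar> + d (x - z k) + d x)"
        using iA iU iD tr[OF iA] tr[OF iU] tr[OF iD] U(2)
        by (intro integral_mono) (auto simp: a_def u_def d_def split: split_indicator)
      also have "\<dots> = (LINT x|lborel. \<bar>u (x - z k) - u x\<bar>) + (LINT x|lborel. d x) + (LINT x|lborel. d x)"
        using iU iD tr[OF iU] tr[OF iD] by (simp add: lborel_translate_integral)
      also have "\<dots> < e" using dle N[OF that] by simp
      finally show ?thesis .
    qed
    then show "\<exists>N. \<forall>k\<ge>N. norm ((LINT x|lborel. \<bar>indicator A (x - z k) - indicator A x\<bar>) - (0::real)) < e"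
      unfolding a_def by (intro exI[of _ N]) (auto simp: abs_of_nonneg integral_nonneg_AE)
  qed
  have "norm (indicator A (x - z k) *\<^sub>R c - indicator A x *\<^sub>R c) =
      \<bar>indicator A (x - z k) - indicator A x\<bar> * norm c" for x k
    by (simp add: scaleR_left_diff_distrib[symmetric])
  then show ?case using tendsto_mult_left[OF ind, of "norm c"] by (simp add: mult.commute)
next
  case (add f g)
  note [measurable] = borel_measurable_integrable[OF add(1)] borel_measurable_integrable[OF add(2)]
  have "(LINT x|lborel. norm (f (x - z k) + g (x - z k) - (f x + g x))) \<le>
     (LINT x|lborel. norm (f (x - z k) - f x)) + (LINT x|lborel. norm (g (x - z k) - g x))" for k
  proof -
    have i: "integrable lborel (\<lambda>x. f (x - z k) - f x)" "integrable lborel (\<lambda>x. g (x - z k) - g x)"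
      using lborel_translate_integrable[OF add(1)] lborel_translate_integrable[OF add(2)] add(1,2) by auto
    have "(LINT x|lborel. norm ((f (x - z k) - f x) + (g (x - z k) - g x))) \<le>
      (LINT x|lborel. norm (f (x - z k) - f x) + norm (g (x - z k) - g x))"
      using i by (intro integral_mono) (auto intro: norm_triangle_ineq)
    then show ?thesis using i by (simp add: algebra_simps)
  qed
  then show ?case
    by (intro tendsto_sandwich[OF _ _ tendsto_const tendsto_add_zero[OF add(3,4)]])
       (auto intro!: always_eventually integral_nonneg_AE)
next
  case (lim f s)
  note [measurable] = borel_measurable_integrable[OF lim(4)] borel_measurable_integrable[OF lim(1)]
  \<comment> \<open>The majorant \<open>3 * norm (f x)\<close> comes from the bound
    \<open>norm (s i x) \<le> 2 * norm (f x)\<close> that the induction rule supplies.\<close>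
  have "(\<lambda>i. LINT x|lborel. norm (f x - s i x)) \<longlonglongrightarrow> (LINT x::'a|lborel. 0)"
  proof (rule integral_dominated_convergence[where w = "\<lambda>x. 3 * norm (f x)"])
    show "AE x in lborel. (\<lambda>i. norm (f x - s i x)) \<longlonglongrightarrow> 0"
    proof (rule AE_I2)
      fix x :: 'a
      have "(\<lambda>i. norm (f x - s i x)) \<longlonglongrightarrow> norm (f x - f x)" using lim(2)[of x] by (intro tendsto_intros) simp
      then show "(\<lambda>i. norm (f x - s i x)) \<longlonglongrightarrow> 0" by simp
    qed
    show "AE x in lborel. norm (norm (f x - s i x)) \<le> 3 * norm (f x)" for i
    proof (rule AE_I2)
      fix x :: 'a
      show "norm (norm (f x - s i x)) \<le> 3 * norm (f x)"
        using lim(3)[of x i] norm_triangle_ineq4[of "f x" "s i x"] by simp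
    qed
  qed (use lim(1,4) in auto)
  then have c: "(\<lambda>i. LINT x|lborel. norm (f x - s i x)) \<longlonglongrightarrow> 0" by simp
  show ?case
  proof (rule LIMSEQ_I)
    fix e :: real assume e: "0 < e"
    from c have "eventually (\<lambda>i. (LINT x|lborel. norm (f x - s i x)) < e / 3) sequentially"
      using e by (intro order_tendstoD) auto
    then obtain i where i: "(LINT x|lborel. norm (f x - s i x)) < e / 3"
      by (auto simp: eventually_sequentially)
    have "eventually (\<lambda>k. (LINT x|lborel. norm (s i (x - z k) - s i x)) < e / 3) sequentially"
      using e by (intro order_tendstoD[OF lim(5)]) auto
    then obtain N where N: "\<And>k. k \<ge> N \<Longrightarrow> (LINT x|lborel. norm (s i (x - z k) - s i x)) < e / 3"
      by (auto simp: eventually_sequentially)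
    have "(LINT x|lborel. norm (f (x - z k) - f x)) < e" if "k \<ge> N" for k
    proof -
      note tr = lborel_translate_integrable
      have fs: "integrable lborel (\<lambda>x. norm (f x - s i x))" using lim(1,4) by auto
      note int = fs tr[OF fs, of "z k"] tr[OF lim(4), of "z k"] tr[OF lim(1)[of i], of "z k"] lim(1)[of i] lim(4)
      have tri: "norm (p - v) \<le> norm (p - q) + norm (q - r) + norm (v - r)" for p q r v :: 'b
        using norm_triangle_ineq[of "p - q" "q - r"] norm_triangle_ineq4[of "p - r" "v - r"] by simp
      have "(LINT x|lborel. norm (f (x - z k) - f x)) \<le>
        (LINT x|lborel. norm (f (x - z k) - s i (x - z k)) + norm (s i (x - z k) - s i x) + norm (f x - s i x))"
        using int by (intro integral_mono tri) auto
      also have "\<dots> = (LINT x|lborel. norm (f x - s i x)) + (LINT x|lborel. norm (s i (x - z k) - s i x)) + (LINT x|lborel. norm (f x - s i x))"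
        using int by (simp add: lborel_translate_integral[of "\<lambda>x. norm (f x - s i x)"])
      also have "\<dots> < e" using i N[OF that] by simp
      finally show ?thesis .
    qed
    then show "\<exists>N. \<forall>k\<ge>N. norm ((LINT x|lborel. norm (f (x - z k) - f x)) - 0) < e"
      by (intro exI[of _ N]) (auto simp: abs_of_nonneg integral_nonneg_AE)
  qed
qed

text \<open>Cut \<open>f\<close> off at height \<open>M\<close>. The remainder is small in L2 by
  dominated convergence, and for the bounded part the squared difference is at most 2M times the
  difference, which reduces the claim to L1.\<close>

lemma L2_translation_continuous:
  fixes f :: "'a::euclidean_space \<Rightarrow> 'b::{banach, second_countable_topology}"
  assumes f: "integrable lborel f" and f2: "integrable lborel (\<lambda>x. (norm (f x))\<^sup>2)"
    and z: "z \<longlonglongrightarrow> 0"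
  shows "(\<lambda>k::nat. LINT x|lborel. (norm (f (x - z k) - f x))\<^sup>2) \<longlonglongrightarrow> 0"
proof (rule LIMSEQ_I)
  fix e :: real assume e: "0 < e"
  note [measurable] = borel_measurable_integrable[OF f]
  define g where "g M x = (if norm (f x) \<le> real M then f x else 0)" for M x
  have [measurable]: "g M \<in> borel_measurable borel" for M
    unfolding g_def by measurable
  have g: "integrable lborel (g M)" for M
    by (rule Bochner_Integration.integrable_bound[OF f]) (auto simp: g_def)
  have fg2: "integrable lborel (\<lambda>x. (norm (f x - g M x))\<^sup>2)" for M
    by (rule Bochner_Integration.integrable_bound[OF f2]) (auto simp: g_def)
  have "(\<lambda>M. LINT x|lborel. (norm (f x - g M x))\<^sup>2) \<longlonglongrightarrow> (LINT x::'a|lborel. 0)"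
  proof (rule integral_dominated_convergence[OF _ _ f2])
    show "AE x in lborel. (\<lambda>M. (norm (f x - g M x))\<^sup>2) \<longlonglongrightarrow> 0"
    proof (rule AE_I2)
      fix x
      obtain M0 :: nat where "norm (f x) \<le> real M0" using real_arch_simple by blast
      then have "(norm (f x - g M x))\<^sup>2 = 0" if "M \<ge> M0" for M
        using that by (auto simp: g_def)
      then show "(\<lambda>M. (norm (f x - g M x))\<^sup>2) \<longlonglongrightarrow> 0"
        by (intro tendsto_eventually) (auto simp: eventually_sequentially)
    qed
  qed (auto simp: g_def)
  \<comment> \<open>Constants: (p + q + r)^2 is at most 3 (p^2 + q^2 + r^2), and q \<le> 2M turns 3
    q^2 into 6 M q. The two remainder terms then cost less than 3 e/12 each, so e/2 is left for the
    L1 term.\<close>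
  then have "eventually (\<lambda>M. (LINT x|lborel. (norm (f x - g M x))\<^sup>2) < e / 12) sequentially"
    using e by (intro order_tendstoD) auto
  then obtain M where M: "(LINT x|lborel. (norm (f x - g M x))\<^sup>2) < e / 12"
    by (auto simp: eventually_sequentially)
  have "(\<lambda>k. 6 * real M * (LINT x|lborel. norm (g M (x - z k) - g M x))) \<longlonglongrightarrow> 6 * real M * 0"
    by (intro tendsto_intros L1_translation_continuous g z)
  then have "eventually (\<lambda>k. 6 * real M * (LINT x|lborel. norm (g M (x - z k) - g M x)) < e / 2) sequentially"
    using e by (intro order_tendstoD) auto
  then obtain N where N: "\<And>k. k \<ge> N \<Longrightarrow> 6 * real M * (LINT x|lborel. norm (g M (x - z k) - g M x)) < e / 2"
    by (auto simp: eventually_sequentially)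
  have "(LINT x|lborel. (norm (f (x - z k) - f x))\<^sup>2) < e" if "k \<ge> N" for k
  proof -
    note int = fg2[of M] lborel_translate_integrable[OF fg2[of M], of "z k"]
      lborel_translate_integrable[OF g[of M], of "z k"] g[of M]
    have "(LINT x|lborel. (norm (f (x - z k) - f x))\<^sup>2) \<le>
      (LINT x|lborel. 3 * (norm (f (x - z k) - g M (x - z k)))\<^sup>2 +
        6 * real M * norm (g M (x - z k) - g M x) + 3 * (norm (f x - g M x))\<^sup>2)"
    proof (rule integral_mono')
      fix x
      let ?p = "norm (f (x - z k) - g M (x - z k))" and ?q = "norm (g M (x - z k) - g M x)"
        and ?r = "norm (f x - g M x)"
      have "norm (f (x - z k) - f x) = norm ((f (x - z k) - g M (x - z k)) + (g M (x - z k) - g M x) - (f x - g M x))"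
        by simp
      also have "\<dots> \<le> ?p + ?q + ?r"
        using norm_triangle_ineq4 norm_triangle_ineq by (meson add_mono order_refl order_trans)
      finally have "(norm (f (x - z k) - f x))\<^sup>2 \<le> (?p + ?q + ?r)\<^sup>2"
        by (intro power_mono) auto
      also have "\<dots> \<le> 3 * ?p\<^sup>2 + 3 * ?q\<^sup>2 + 3 * ?r\<^sup>2"
        using zero_le_power2[of "?p - ?q"] zero_le_power2[of "?q - ?r"] zero_le_power2[of "?p - ?r"]
        by (simp add: power2_eq_square algebra_simps)
      also have "?q\<^sup>2 \<le> 2 * real M * ?q"
      proof -
        have "?q \<le> 2 * real M"
          using norm_triangle_ineq4[of "g M (x - z k)" "g M x"] by (simp add: g_def split: if_splits)
        then show ?thesis by (simp add: power2_eq_square mult_right_mono)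
      qed
      finally show "(norm (f (x - z k) - f x))\<^sup>2 \<le> 3 * ?p\<^sup>2 + 6 * real M * ?q + 3 * ?r\<^sup>2"
        by simp
    qed (use int in auto)
    also have "\<dots> = 3 * (LINT x|lborel. (norm (f x - g M x))\<^sup>2) +
        6 * real M * (LINT x|lborel. norm (g M (x - z k) - g M x)) + 3 * (LINT x|lborel. (norm (f x - g M x))\<^sup>2)"
      using int by (simp add: lborel_translate_integral[of "\<lambda>x. (norm (f x - g M x))\<^sup>2"])
    also have "\<dots> < e" using M N[OF that] by simp
    finally show ?thesis .
  qed
  then show "\<exists>N. \<forall>k\<ge>N. norm ((LINT x|lborel. (norm (f (x - z k) - f x))\<^sup>2) - 0) < e"
    by (intro exI[of _ N]) auto
qed

lemma
  fixes a :: "'a::euclidean_space \<Rightarrow> 'c::{real_normed_field, banach, second_countable_topology}"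
    and b :: "'b::euclidean_space \<Rightarrow> 'c"
  assumes a: "integrable lborel a" and b: "integrable lborel b"
  shows integrable_lborel_pair_mult: "integrable (lborel \<Otimes>\<^sub>M lborel) (\<lambda>p. a (fst p) * b (snd p))"
    and integral_lborel_pair_mult:
      "(LINT p|(lborel \<Otimes>\<^sub>M lborel). a (fst p) * b (snd p)) = (LINT x|lborel. a x) * (LINT y|lborel. b y)"
proof -
  note [measurable] = borel_measurable_integrable[OF a] borel_measurable_integrable[OF b]
  show "integrable (lborel \<Otimes>\<^sub>M lborel) (\<lambda>p. a (fst p) * b (snd p))"
    by (rule lborel_pair.Fubini_integrable) (use a b in \<open>auto simp: norm_mult\<close>)
  from lborel_pair.integral_fst'[OF this]
  show "(LINT p|(lborel \<Otimes>\<^sub>M lborel). a (fst p) * b (snd p)) = (LINT x|lborel. a x) * (LINT y|lborel. b y)"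
    by simp
qed

text \<open>Substitute \<open>w = s *\<^sub>R \<xi>\<close> in \<open>gauss_fourier\<close>. Writing
  the resulting exponential as a \<open>gauss\<close> again exhibits the density of
  \<open>s *\<^sub>R w\<close> for a standard normal \<open>w\<close>, an approximate identity as s
  tends to 0.\<close>

lemma gauss_fourier_scaled:
  fixes z :: "'a::euclidean_space"
  assumes s: "s > 0"
  shows "(LINT \<xi>|lborel. cis (z \<bullet> \<xi>) * of_real (gauss (s *\<^sub>R \<xi>))) =
    of_real ((2 * pi) powr (real DIM('a) / 2) * gauss (z /\<^sub>R s) / s ^ DIM('a))"
proof -
  have "of_real (exp (- (norm (z /\<^sub>R s))\<^sup>2 / 2)) =
     (s ^ DIM('a)) *\<^sub>R (LINT \<xi>|lborel. cis ((z /\<^sub>R s) \<bullet> (s *\<^sub>R \<xi>)) * of_real (gauss (s *\<^sub>R \<xi>)))"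
    using lborel_affine_integral[of "\<lambda>w. cis ((z /\<^sub>R s) \<bullet> w) * of_real (gauss w)" s 0] s
      gauss_fourier[of "z /\<^sub>R s"] by (simp add: cis_conv_exp)
  moreover have "(2 * pi) powr (real DIM('a) / 2) * gauss (z /\<^sub>R s) = exp (- (norm (z /\<^sub>R s))\<^sup>2 / 2)"
    unfolding gauss_eq by (simp add: powr_minus)
  ultimately show ?thesis
    using s by (simp add: scaleR_conv_of_real field_simps)
qed

section \<open>Plancherel's theorem\<close>

lemma cis_measurable [measurable (raw)]:
  "g \<in> borel_measurable M \<Longrightarrow> (\<lambda>x. cis (g x)) \<in> borel_measurable M"
  unfolding cis_conv_exp by measurable

lemma cnj_measurable [measurable (raw)]:
  "g \<in> borel_measurable M \<Longrightarrow> (\<lambda>x. cnj (g x)) \<in> borel_measurable M"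
  by (rule borel_measurable_continuous_on[of cnj]) (intro continuous_intros)

lemma integrable_gauss_scaled: "s > 0 \<Longrightarrow> integrable lborel (\<lambda>\<xi>::'a::euclidean_space. gauss (s *\<^sub>R \<xi>))"
  using lborel_affine_integrable[OF integrable_gauss, of s 0] by simp

lemma norm_diff_square: "(norm (a - b))\<^sup>2 = (norm a)\<^sup>2 + (norm b)\<^sup>2 - 2 * Re (b * cnj a)" for a b :: complex
  unfolding cmod_power2 by (simp add: power2_eq_square algebra_simps)

section \<open>Plancherel for integrable, square integrable functions\<close>

text \<open>The transform without its normalising constant and over \<open>lborel\<close>, where
  Borel measurability on product spaces makes Fubini convenient. The constant returns in
  \<open>fourier_integral_plancherel\<close>.\<close>

definition raw_fourier :: "('a::euclidean_space \<Rightarrow> complex) \<Rightarrow> 'a \<Rightarrow> complex" where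
  "raw_fourier f \<xi> = (LINT x|lborel. cis (- (x \<bullet> \<xi>)) * f x)"

context
  fixes f :: "'a::euclidean_space \<Rightarrow> complex"
  assumes f: "integrable lborel f"
begin

lemma [measurable]: "f \<in> borel_measurable borel"
  using f by auto

lemma raw_fourier_measurable [measurable]: "raw_fourier f \<in> borel_measurable borel"
  unfolding raw_fourier_def by measurable

lemma integrable_cis: "integrable lborel (\<lambda>x. cis (- (x \<bullet> \<xi>)) * f x)"
  by (rule Bochner_Integration.integrable_bound[OF f]) (auto simp: norm_mult)

lemma raw_fourier_bound: "norm (raw_fourier f \<xi>) \<le> (LINT x|lborel. norm (f x))"
  unfolding raw_fourier_def by (rule order_trans[OF integral_norm_bound]) (simp add: norm_mult)

text \<open>The transform of an integrable function is bounded, so the Gaussian weight makes its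
  square integrable before square integrability of the transform itself is known.\<close>

lemma raw_fourier_gauss_integrable:
  assumes "s > 0"
  shows "integrable lborel (\<lambda>\<xi>. (norm (raw_fourier f \<xi>))\<^sup>2 * gauss (s *\<^sub>R \<xi>))"
proof (rule Bochner_Integration.integrable_bound)
  let ?B = "LINT x|lborel. norm (f x)"
  show "integrable lborel (\<lambda>\<xi>::'a. ?B\<^sup>2 * gauss (s *\<^sub>R \<xi>))"
    by (intro integrable_mult_right integrable_gauss_scaled assms)
  show "AE \<xi> in lborel. norm ((norm (raw_fourier f \<xi>))\<^sup>2 * gauss (s *\<^sub>R \<xi>)) \<le> norm (?B\<^sup>2 * gauss (s *\<^sub>R \<xi>))"
    using gauss_pos by (intro AE_I2) (auto simp: abs_mult intro!: mult_right_mono power_mono raw_fourier_bound)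
qed measurable

text \<open>For fixed s the Gaussian kernel is bounded by a constant, and the tensor product of
  \<open>f\<close> with its conjugate is integrable because \<open>f\<close> is.\<close>

lemma correlation_integrable:
  assumes s: "s > 0"
  shows "integrable (lborel \<Otimes>\<^sub>M lborel)
    (\<lambda>p. f (fst p) * cnj (f (snd p)) * of_real (gauss ((fst p - snd p) /\<^sub>R s) / s ^ DIM('a)))"
proof (rule Bochner_Integration.integrable_bound)
  let ?k = "(2 * pi) powr (- real DIM('a) / 2) / s ^ DIM('a)"
  show "integrable (lborel \<Otimes>\<^sub>M lborel) (\<lambda>p. complex_of_real ?k * (f (fst p) * cnj (f (snd p))))"
    using integrable_lborel_pair_mult[OF f integrable_cnj[OF f]] by (intro integrable_mult_right)
  show "AE p in lborel \<Otimes>\<^sub>M lborel.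
      norm (f (fst p) * cnj (f (snd p)) * of_real (gauss ((fst p - snd p) /\<^sub>R s) / s ^ DIM('a))) \<le>
      norm (complex_of_real ?k * (f (fst p) * cnj (f (snd p))))"
  proof (rule AE_I2)
    fix p :: "'a \<times> 'a"
    have "norm (complex_of_real (gauss ((fst p - snd p) /\<^sub>R s) / s ^ DIM('a))) \<le> ?k"
      using s gauss_pos[of "(fst p - snd p) /\<^sub>R s"]
      by (simp add: norm_divide norm_power divide_right_mono gauss_le[simplified])
    also have "?k = norm (complex_of_real ?k)" using s by (simp add: norm_divide norm_power)
    finally show "norm (f (fst p) * cnj (f (snd p)) * of_real (gauss ((fst p - snd p) /\<^sub>R s) / s ^ DIM('a))) \<le>
      norm (complex_of_real ?k * (f (fst p) * cnj (f (snd p))))"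
      unfolding norm_mult by (subst mult.commute) (rule mult_right_mono, auto)
  qed
qed measurable

text \<open>Expand the squared modulus as a double integral over x and y with phase (y - x)
  \<bullet> \<xi>, and integrate over \<xi> first: the inner integral is the transform of the scaled
  Gaussian.\<close>

lemma raw_fourier_gauss_pair:
  assumes s: "s > 0"
  shows "(LINT \<xi>|lborel. (norm (raw_fourier f \<xi>))\<^sup>2 * gauss (s *\<^sub>R \<xi>)) =
    (2 * pi) powr (real DIM('a) / 2) *
    (LINT p|(lborel \<Otimes>\<^sub>M lborel). Re (f (fst p) * cnj (f (snd p))) * (gauss ((fst p - snd p) /\<^sub>R s) / s ^ DIM('a)))"
    (is "?L = ?c * ?R")
proof -
  define H where "H p = f (fst p) * cnj (f (snd p))" for p
  have [measurable]: "H \<in> borel_measurable borel"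
    unfolding H_def borel_prod[symmetric] by measurable
  have cf: "integrable lborel (\<lambda>x. cnj (f x))" using f by simp
  have H: "integrable lborel H"
    using integrable_lborel_pair_mult[OF f cf] unfolding lborel_prod H_def .
  have sq: "of_real ((norm (raw_fourier f \<xi>))\<^sup>2) = (LINT p|lborel. cis ((snd p - fst p) \<bullet> \<xi>) * H p)" for \<xi>
  proof -
    have i: "integrable lborel (\<lambda>y. cnj (cis (- (y \<bullet> \<xi>)) * f y))"
      using integrable_cis[of \<xi>] by (simp del: complex_cnj_mult)
    have "of_real ((norm (raw_fourier f \<xi>))\<^sup>2) = raw_fourier f \<xi> * cnj (raw_fourier f \<xi>)"
      by (rule complex_norm_square)
    also have "cnj (raw_fourier f \<xi>) = (LINT y|lborel. cnj (cis (- (y \<bullet> \<xi>)) * f y))"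
      unfolding raw_fourier_def by (rule Bochner_Integration.integral_cnj[symmetric])
    also have "raw_fourier f \<xi> * \<dots> = (LINT p|lborel. (cis (- (fst p \<bullet> \<xi>)) * f (fst p)) * cnj (cis (- (snd p \<bullet> \<xi>)) * f (snd p)))"
      unfolding raw_fourier_def by (subst integral_lborel_pair_mult[OF integrable_cis i, symmetric]) (simp only: lborel_prod)
    also have "\<dots> = (LINT p|lborel. cis ((snd p - fst p) \<bullet> \<xi>) * H p)"
    proof (rule Bochner_Integration.integral_cong)
      fix p :: "'a \<times> 'a"
      have "cis ((snd p - fst p) \<bullet> \<xi>) = cis (- (fst p \<bullet> \<xi>)) * cis (snd p \<bullet> \<xi>)"
        by (simp add: cis_mult inner_diff_left)
      then show "cis (- (fst p \<bullet> \<xi>)) * f (fst p) * cnj (cis (- (snd p \<bullet> \<xi>)) * f (snd p)) =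
        cis ((snd p - fst p) \<bullet> \<xi>) * H p"
        by (simp add: H_def cis_cnj)
    qed simp
    finally show ?thesis .
  qed
  define G where "G \<xi> p = of_real (gauss (s *\<^sub>R \<xi>)) * (cis ((snd p - fst p) \<bullet> \<xi>) * H p)" for \<xi> :: 'a and p :: "'a \<times> 'a"
  have [measurable]: "case_prod G \<in> borel_measurable (lborel \<Otimes>\<^sub>M lborel)"
  proof -
    have "(\<lambda>x::'a \<times> ('a \<times> 'a). (snd (snd x) - fst (snd x)) \<bullet> fst x) \<in> borel_measurable borel"
      by (intro borel_measurable_continuous_onI continuous_intros)
    then have [measurable]: "(\<lambda>x::'a \<times> ('a \<times> 'a). (snd (snd x) - fst (snd x)) \<bullet> fst x) \<in> borel_measurable (lborel \<Otimes>\<^sub>M lborel)"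
      unfolding lborel_prod by simp
    show ?thesis
      unfolding G_def split_beta' by measurable
  qed
  have i: "integrable lborel (\<lambda>\<xi>::'a. complex_of_real (gauss (s *\<^sub>R \<xi>)))"
    by (intro integrable_of_real integrable_gauss_scaled s)
  \<comment> \<open>The phase has modulus one, so the product of the Gaussian in \<xi> and
    \<open>H\<close> in p dominates \<open>G\<close>; this justifies exchanging the
    integrals.\<close>
  have G: "integrable (lborel \<Otimes>\<^sub>M lborel) (case_prod G)"
  proof (rule Bochner_Integration.integrable_bound)
    show "integrable (lborel \<Otimes>\<^sub>M lborel) (\<lambda>q::'a \<times> ('a \<times> 'a). complex_of_real (gauss (s *\<^sub>R fst q)) * H (snd q))"
      by (rule integrable_lborel_pair_mult[OF i H])
  qed (auto simp: G_def norm_mult)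
  have "of_real ?L = (LINT \<xi>|lborel. LINT p|lborel. G \<xi> p)"
    unfolding G_def integral_complex_of_real[symmetric]
    by (rule Bochner_Integration.integral_cong[OF refl])
       (simp only: integral_mult_right_zero of_real_mult sq mult.commute)
  also have "\<dots> = (LINT p|lborel. LINT \<xi>|lborel. G \<xi> p)"
    by (rule lborel_pair.Fubini_integral[symmetric, OF G])
  also have "\<dots> = (LINT p|lborel. of_real ?c * (H p * of_real (gauss ((fst p - snd p) /\<^sub>R s) / s ^ DIM('a))))"
  proof (rule Bochner_Integration.integral_cong)
    fix p :: "'a \<times> 'a"
    have "(LINT \<xi>|lborel. G \<xi> p) = H p * (LINT \<xi>|lborel. cis ((snd p - fst p) \<bullet> \<xi>) * of_real (gauss (s *\<^sub>R \<xi>)))"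
      unfolding G_def by (subst integral_mult_right_zero[symmetric]) (simp add: mult_ac)
    also have "\<dots> = of_real ?c * (H p * of_real (gauss ((snd p - fst p) /\<^sub>R s) / s ^ DIM('a)))"
      unfolding gauss_fourier_scaled[OF s] by simp
    also have "gauss ((snd p - fst p) /\<^sub>R s) = gauss ((fst p - snd p) /\<^sub>R s)"
      using gauss_minus[of "(snd p - fst p) /\<^sub>R s"] by (simp flip: scaleR_minus_right)
    finally show "(LINT \<xi>|lborel. G \<xi> p) = of_real ?c * (H p * of_real (gauss ((fst p - snd p) /\<^sub>R s) / s ^ DIM('a)))" .
  qed simp
  also have "\<dots> = of_real ?c * (LINT p|lborel. (H p * of_real (gauss ((fst p - snd p) /\<^sub>R s) / s ^ DIM('a))))"
    by simp
  \<comment> \<open>The left side is real, so taking real parts loses nothing; the weight is real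
    too, which leaves the real part of \<open>H p\<close>.\<close>
  finally have "?L = Re \<dots>"
    by (metis Re_complex_of_real)
  also have "\<dots> = ?c * Re (LINT p|lborel. (H p * of_real (gauss ((fst p - snd p) /\<^sub>R s) / s ^ DIM('a))))"
    by simp
  also have "Re (LINT p|lborel. (H p * of_real (gauss ((fst p - snd p) /\<^sub>R s) / s ^ DIM('a)))) =
     (LINT p|lborel. Re (H p * of_real (gauss ((fst p - snd p) /\<^sub>R s) / s ^ DIM('a))))"
    using correlation_integrable[OF s] unfolding lborel_prod H_def
    by (rule Bochner_Integration.integral_Re[symmetric])
  finally show ?thesis
    by (simp add: H_def lborel_prod)
qed

end

context
  fixes f :: "'a::euclidean_space \<Rightarrow> complex"
  assumes f: "integrable lborel f" and f2: "integrable lborel (\<lambda>x. (norm (f x))\<^sup>2)"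
begin

lemma [measurable]: "f \<in> borel_measurable borel"
  using f by auto

lemma translate_diff_integrable: "integrable lborel (\<lambda>x. (norm (f (x - z) - f x))\<^sup>2)"
proof (rule Bochner_Integration.integrable_bound)
  show "integrable lborel (\<lambda>x. 2 * (norm (f (x - z)))\<^sup>2 + 2 * (norm (f x))\<^sup>2)"
    using f2 lborel_translate_integrable[OF f2, of z] by simp
  show "AE x in lborel. norm ((norm (f (x - z) - f x))\<^sup>2) \<le> norm (2 * (norm (f (x - z)))\<^sup>2 + 2 * (norm (f x))\<^sup>2)"
  proof (rule AE_I2)
    fix x
    have "(norm (f (x - z) - f x))\<^sup>2 \<le> (norm (f (x - z)) + norm (f x))\<^sup>2"
      by (intro power_mono norm_triangle_ineq4) auto
    also have "\<dots> \<le> 2 * (norm (f (x - z)))\<^sup>2 + 2 * (norm (f x))\<^sup>2"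
      using sum_squares_bound[of "norm (f (x - z))" "norm (f x)"] by (simp add: power2_sum)
    finally show "norm ((norm (f (x - z) - f x))\<^sup>2) \<le> norm (2 * (norm (f (x - z)))\<^sup>2 + 2 * (norm (f x))\<^sup>2)"
      by simp
  qed
qed measurable

text \<open>Polarisation: the real part of a product with a conjugate is half of the two squared
  norms minus the squared distance. Continuity of the autocorrelation at 0 thereby becomes
  continuity of translation in L2.\<close>

lemma
  shows autocorrelation_integrable: "integrable lborel (\<lambda>x. Re (f x * cnj (f (x - z))))"
    and autocorrelation_eq: "(LINT x|lborel. Re (f x * cnj (f (x - z)))) =
      (LINT x|lborel. (norm (f x))\<^sup>2) - (LINT x|lborel. (norm (f (x - z) - f x))\<^sup>2) / 2"
proof -
  have eq: "Re (f x * cnj (f (x - z))) =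
      ((norm (f (x - z)))\<^sup>2 + (norm (f x))\<^sup>2 - (norm (f (x - z) - f x))\<^sup>2) / 2" for x
    by (simp only: norm_diff_square) simp
  show "integrable lborel (\<lambda>x. Re (f x * cnj (f (x - z))))"
    unfolding eq using f2 lborel_translate_integrable[OF f2, of z] translate_diff_integrable[of z] by simp
  show "(LINT x|lborel. Re (f x * cnj (f (x - z)))) =
      (LINT x|lborel. (norm (f x))\<^sup>2) - (LINT x|lborel. (norm (f (x - z) - f x))\<^sup>2) / 2"
    unfolding eq using f2 lborel_translate_integrable[OF f2, of z] translate_diff_integrable[of z]
    by (simp add: lborel_translate_integral[of "\<lambda>x. (norm (f x))\<^sup>2"] field_simps)
qed

text \<open>Follows from 2ab \<le> a^2 + b^2 and translation invariance. The bound is uniform in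
  \<open>z\<close>, so it serves both for Fubini and as a majorant in the limit.\<close>

lemma autocorrelation_abs:
  "(LINT x|lborel. \<bar>Re (f x * cnj (f (x - z)))\<bar>) \<le> (LINT x|lborel. (norm (f x))\<^sup>2)"
proof -
  have "(LINT x|lborel. \<bar>Re (f x * cnj (f (x - z)))\<bar>) \<le>
      (LINT x|lborel. (norm (f x))\<^sup>2 / 2 + (norm (f (x - z)))\<^sup>2 / 2)"
  proof (rule integral_mono')
    show "integrable lborel (\<lambda>x. (norm (f x))\<^sup>2 / 2 + (norm (f (x - z)))\<^sup>2 / 2)"
      using f2 lborel_translate_integrable[OF f2, of z] by simp
    fix x
    have "\<bar>Re (f x * cnj (f (x - z)))\<bar> \<le> norm (f x) * norm (f (x - z))"
      using abs_Re_le_cmod[of "f x * cnj (f (x - z))"] by (simp add: norm_mult)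
    then show "\<bar>Re (f x * cnj (f (x - z)))\<bar> \<le> (norm (f x))\<^sup>2 / 2 + (norm (f (x - z)))\<^sup>2 / 2"
      using sum_squares_bound[of "norm (f x)" "norm (f (x - z))"] by simp
  qed simp
  also have "\<dots> = (LINT x|lborel. (norm (f x))\<^sup>2)"
    using f2 lborel_translate_integrable[OF f2, of z]
    by (simp add: lborel_translate_integral[of "\<lambda>x. (norm (f x))\<^sup>2"])
  finally show ?thesis .
qed

text \<open>Measuring the displacement x - y in units of s moves the dependence on s from the
  Gaussian kernel into the argument of the autocorrelation; Fubini then puts the Gaussian average
  outside.\<close>

lemma raw_fourier_gauss_autocorrelation:
  assumes s: "s > 0"
  shows "(LINT \<xi>|lborel. (norm (raw_fourier f \<xi>))\<^sup>2 * gauss (s *\<^sub>R \<xi>)) =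
    (2 * pi) powr (real DIM('a) / 2) *
    (LINT w|lborel. gauss w * (LINT x|lborel. Re (f x * cnj (f (x - s *\<^sub>R w)))))"
proof -
  let ?N = "LINT x|lborel. (norm (f x))\<^sup>2"
  define G where "G w x = Re (f x * cnj (f (x - s *\<^sub>R w))) * gauss w" for w x
  have mG [measurable]: "case_prod G \<in> borel_measurable (lborel \<Otimes>\<^sub>M lborel)"
    unfolding G_def by measurable
  have G: "integrable (lborel \<Otimes>\<^sub>M lborel) (case_prod G)"
  proof (rule lborel_pair.Fubini_integrable[OF mG])
    show "integrable lborel (\<lambda>w. LINT x|lborel. norm (case_prod G (w, x)))"
    proof (rule Bochner_Integration.integrable_bound)
      show "integrable lborel (\<lambda>w::'a. ?N * gauss w)" by (simp add: integrable_gauss)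
      show "AE w in lborel. norm (LINT x|lborel. norm (case_prod G (w, x))) \<le> norm (?N * gauss w)"
        using gauss_pos autocorrelation_abs
        by (intro AE_I2) (auto simp: G_def abs_mult abs_of_pos intro!: mult_right_mono integral_nonneg_AE)
    qed measurable
    show "AE w in lborel. integrable lborel (\<lambda>x. case_prod G (w, x))"
      using autocorrelation_integrable by (auto simp: G_def simp del: times_complex.sel)
  qed
  let ?k = "\<lambda>x y. gauss ((x - y) /\<^sub>R s) / s ^ DIM('a)"
  have Re_mult_real: "Re (z * of_real r) = Re z * r" for z r by simp
  have "integrable (lborel \<Otimes>\<^sub>M lborel) (\<lambda>p. Re (f (fst p) * cnj (f (snd p)) * of_real (?k (fst p) (snd p))))"
    by (rule integrable_Re[OF correlation_integrable[OF f s]])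
  then have int: "integrable (lborel \<Otimes>\<^sub>M lborel) (\<lambda>p. Re (f (fst p) * cnj (f (snd p))) * ?k (fst p) (snd p))"
    by (simp only: Re_mult_real)
  have "(LINT p|(lborel \<Otimes>\<^sub>M lborel). Re (f (fst p) * cnj (f (snd p))) * ?k (fst p) (snd p)) =
      (LINT x|lborel. LINT y|lborel. Re (f x * cnj (f y)) * ?k x y)"
    by (subst lborel_pair.integral_fst'[OF int, symmetric]) simp
  also have "\<dots> = (LINT x|lborel. LINT w|lborel. G w x)"
  proof (rule Bochner_Integration.integral_cong)
    fix x :: 'a
    \<comment> \<open>Substitution y = x - s w: the Jacobian s^n cancels the denominator of the
      kernel.\<close>
    have "(LINT y|lborel. Re (f x * cnj (f y)) * ?k x y) =
      (\<bar>- s\<bar> ^ DIM('a)) *\<^sub>R (LINT w|lborel. Re (f x * cnj (f (x + (- s) *\<^sub>R w))) * ?k x (x + (- s) *\<^sub>R w))"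
      by (rule lborel_affine_integral) (use s in auto)
    also have "\<dots> = (LINT w|lborel. s ^ DIM('a) * (Re (f x * cnj (f (x + (- s) *\<^sub>R w))) * ?k x (x + (- s) *\<^sub>R w)))"
      using s by simp
    also have "\<dots> = (LINT w|lborel. G w x)"
      using s by (intro Bochner_Integration.integral_cong) (simp_all add: G_def)
    finally show "(LINT y|lborel. Re (f x * cnj (f y)) * ?k x y) = (LINT w|lborel. G w x)" .
  qed simp
  also have "\<dots> = (LINT w|lborel. LINT x|lborel. G w x)"
    by (rule lborel_pair.Fubini_integral[OF G])
  also have "\<dots> = (LINT w|lborel. gauss w * (LINT x|lborel. Re (f x * cnj (f (x - s *\<^sub>R w)))))"
    by (simp add: G_def mult.commute)
  finally show ?thesis
    unfolding raw_fourier_gauss_pair[OF f s] by simp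
qed

text \<open>For each fixed w the autocorrelation at w/(k+1) tends to its value at 0, the squared
  norm of \<open>f\<close>. The majorant \<open>gauss w * ?N\<close> permits passing to the limit,
  and \<open>gauss\<close> has total mass 1.\<close>

lemma raw_fourier_gauss_limit:
  "(\<lambda>k. LINT \<xi>|lborel. (norm (raw_fourier f \<xi>))\<^sup>2 * gauss ((1 / real (Suc k)) *\<^sub>R \<xi>)) \<longlonglongrightarrow>
    (2 * pi) powr (real DIM('a) / 2) * (LINT x|lborel. (norm (f x))\<^sup>2)"
proof -
  let ?N = "LINT x|lborel. (norm (f x))\<^sup>2"
  define A where "A z = (LINT x|lborel. Re (f x * cnj (f (x - z))))" for z
  have [measurable]: "A \<in> borel_measurable borel"
    unfolding A_def by measurable
  have lim: "(\<lambda>k. LINT w|lborel. gauss w * A ((1 / real (Suc k)) *\<^sub>R w)) \<longlonglongrightarrow> (LINT w|lborel. gauss (w::'a) * ?N)"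
  proof (rule integral_dominated_convergence)
    show "integrable lborel (\<lambda>w::'a. gauss w * ?N)"
      by (simp add: integrable_gauss)
    show "AE w in lborel. (\<lambda>k. gauss w * A ((1 / real (Suc k)) *\<^sub>R w)) \<longlonglongrightarrow> gauss w * ?N"
    proof (rule AE_I2)
      fix w :: 'a
      have "(\<lambda>k. (1 / real (Suc k)) *\<^sub>R w) \<longlonglongrightarrow> 0 *\<^sub>R w"
        by (intro tendsto_intros LIMSEQ_Suc lim_1_over_n)
      \<comment> \<open>The limit is written in the shape of \<open>autocorrelation_eq\<close>,
        whose subtracted term is half the squared L2 distance of \<open>f\<close> from its
        translate.\<close>
      then have "(\<lambda>k. A ((1 / real (Suc k)) *\<^sub>R w)) \<longlonglongrightarrow> ?N - 0 / 2"
        unfolding A_def autocorrelation_eq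
        by (intro tendsto_intros L2_translation_continuous f f2) auto
      then show "(\<lambda>k. gauss w * A ((1 / real (Suc k)) *\<^sub>R w)) \<longlonglongrightarrow> gauss w * ?N"
        by (intro tendsto_intros) simp
    qed
    show "AE w in lborel. norm (gauss w * A ((1 / real (Suc k)) *\<^sub>R w)) \<le> gauss w * ?N" for k
    proof (rule AE_I2)
      fix w :: 'a
      have "\<bar>A z\<bar> \<le> ?N" for z
        unfolding A_def by (rule order_trans[OF integral_abs_bound autocorrelation_abs])
      then show "norm (gauss w * A ((1 / real (Suc k)) *\<^sub>R w)) \<le> gauss w * ?N"
        using gauss_pos[of w] by (simp add: abs_mult)
    qed
  qed measurable
  show ?thesis
    using tendsto_mult_left[OF lim, of "(2 * pi) powr (real DIM('a) / 2)"]
    by (simp add: raw_fourier_gauss_autocorrelation A_def integral_gauss del: of_nat_Suc)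
qed

text \<open>Multiplied by \<open>?c\<close>, the Gaussian weight is exp(-(s |\<xi>|)^2 / 2), which
  increases to 1 as s decreases to 0. Monotone convergence therefore yields square integrability
  together with the value of the integral.\<close>

lemma
  shows raw_fourier_square_integrable: "integrable lborel (\<lambda>\<xi>. (norm (raw_fourier f \<xi>))\<^sup>2)"
    and raw_fourier_plancherel: "(LINT \<xi>|lborel. (norm (raw_fourier f \<xi>))\<^sup>2) = (2 * pi) powr DIM('a) * (LINT x|lborel. (norm (f x))\<^sup>2)"
proof -
  let ?c = "(2 * pi) powr (real DIM('a) / 2)"
  define s where "s k = 1 / real (Suc k)" for k
  have s: "s k > 0" for k by (simp add: s_def)
  have eq: "?c * gauss (s k *\<^sub>R \<xi>) = exp (- (s k * norm \<xi>)\<^sup>2 / 2)" for k and \<xi> :: 'a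
    unfolding gauss_eq using s[of k] by (simp add: powr_minus power_mult_distrib)
  have mono: "mono (\<lambda>k. (norm (raw_fourier f \<xi>))\<^sup>2 * (?c * gauss (s k *\<^sub>R \<xi>)))" for \<xi>
    unfolding eq
    by (intro monoI mult_left_mono) (auto simp: s_def frac_le intro!: power_mono mult_right_mono)
  have lim: "(\<lambda>k. (norm (raw_fourier f \<xi>))\<^sup>2 * (?c * gauss (s k *\<^sub>R \<xi>))) \<longlonglongrightarrow> (norm (raw_fourier f \<xi>))\<^sup>2" for \<xi>
  proof -
    have "s \<longlonglongrightarrow> 0"
      unfolding s_def[abs_def] by (intro LIMSEQ_Suc lim_1_over_n)
    then have "(\<lambda>k. (norm (raw_fourier f \<xi>))\<^sup>2 * exp (- (s k * norm \<xi>)\<^sup>2 / 2)) \<longlonglongrightarrow> (norm (raw_fourier f \<xi>))\<^sup>2 * exp (- (0 * norm \<xi>)\<^sup>2 / 2)"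
      by (intro tendsto_intros) auto
    then show ?thesis unfolding eq by simp
  qed
  have int: "integrable lborel (\<lambda>\<xi>. (norm (raw_fourier f \<xi>))\<^sup>2 * (?c * gauss (s k *\<^sub>R \<xi>)))" for k
    using integrable_mult_right[OF raw_fourier_gauss_integrable[OF f s[of k]], of ?c] by (simp add: mult_ac)
  have "(\<lambda>k. ?c * (LINT \<xi>|lborel. (norm (raw_fourier f \<xi>))\<^sup>2 * gauss (s k *\<^sub>R \<xi>))) \<longlonglongrightarrow>
      ?c * (?c * (LINT x|lborel. (norm (f x))\<^sup>2))"
    unfolding s_def by (intro tendsto_mult_left raw_fourier_gauss_limit)
  also have "(\<lambda>k. ?c * (LINT \<xi>|lborel. (norm (raw_fourier f \<xi>))\<^sup>2 * gauss (s k *\<^sub>R \<xi>))) =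
     (\<lambda>k. LINT \<xi>|lborel. (norm (raw_fourier f \<xi>))\<^sup>2 * (?c * gauss (s k *\<^sub>R \<xi>)))"
    by (subst integral_mult_right_zero[symmetric]) (simp add: mult_ac)
  also have "?c * (?c * (LINT x|lborel. (norm (f x))\<^sup>2)) = (2 * pi) powr DIM('a) * (LINT x|lborel. (norm (f x))\<^sup>2)"
    by (simp flip: powr_add mult.assoc)
  finally have ilim: "(\<lambda>k. LINT \<xi>|lborel. (norm (raw_fourier f \<xi>))\<^sup>2 * (?c * gauss (s k *\<^sub>R \<xi>))) \<longlonglongrightarrow>
     (2 * pi) powr DIM('a) * (LINT x|lborel. (norm (f x))\<^sup>2)" .
  have meas: "(\<lambda>\<xi>. (norm (raw_fourier f \<xi>))\<^sup>2) \<in> borel_measurable lborel"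
    using raw_fourier_measurable[OF f] by simp
  show "integrable lborel (\<lambda>\<xi>. (norm (raw_fourier f \<xi>))\<^sup>2)"
    by (rule integrable_monotone_convergence[OF int AE_I2[OF mono] AE_I2[OF lim] ilim meas])
  show "(LINT \<xi>|lborel. (norm (raw_fourier f \<xi>))\<^sup>2) = (2 * pi) powr DIM('a) * (LINT x|lborel. (norm (f x))\<^sup>2)"
    by (rule integral_monotone_convergence[OF int AE_I2[OF mono] AE_I2[OF lim] ilim meas])
qed

end

section \<open>Extension of Plancherel to all of L2 by truncation\<close>

text \<open>Extended values keep the quantity meaningful without integrability conditions, and it is
  the very expression whose limit defines \<open>has_L2_fourier\<close>.\<close>

definition L2_energy :: "('a::euclidean_space \<Rightarrow> complex) \<Rightarrow> ennreal" where
  "L2_energy f = (\<integral>\<^sup>+x. ennreal ((norm (f x))\<^sup>2) \<partial>lebesgue)"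

text \<open>Carries results for Borel functions over \<open>lborel\<close> to Lebesgue measurable
  ones; the representative is built from those of the real and imaginary parts.\<close>

lemma lebesgue_complex_AE_borel:
  fixes f :: "'a::euclidean_space \<Rightarrow> complex"
  assumes [measurable]: "f \<in> borel_measurable lebesgue"
  obtains g where "g \<in> borel_measurable borel" "AE x in lebesgue. f x = g x"
proof -
  obtain a b where [measurable]: "a \<in> borel_measurable lborel" "b \<in> borel_measurable lborel"
    and "AE x in lborel. Re (f x) = a x" "AE x in lborel. Im (f x) = b x"
    using completion_ex_borel_measurable_real[of "\<lambda>x. Re (f x)" lborel]
      completion_ex_borel_measurable_real[of "\<lambda>x. Im (f x)" lborel] by auto
  then have "AE x in lebesgue. f x = Complex (a x) (b x)"
    by (auto intro!: AE_completion simp: complex_eq_iff elim: eventually_elim2)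
  moreover have "(\<lambda>x. Complex (a x) (b x)) \<in> borel_measurable borel"
    unfolding Complex_eq by measurable
  ultimately show ?thesis using that by blast
qed

text \<open>Passing to a Borel representative changes none of the integrals, and the square of the
  normalising constant cancels the factor (2 pi)^n of \<open>raw_fourier_plancherel\<close>.\<close>

lemma
  fixes f :: "'a::euclidean_space \<Rightarrow> complex"
  assumes f: "integrable lebesgue f" and f2: "integrable lebesgue (\<lambda>x. (norm (f x))\<^sup>2)"
  shows fourier_integral_measurable: "fourier_integral f \<in> borel_measurable lebesgue"
    and fourier_integral_plancherel: "L2_energy (fourier_integral f) = L2_energy f"
proof -
  have fm [measurable]: "f \<in> borel_measurable lebesgue" using f by auto
  obtain g where gm [measurable]: "g \<in> borel_measurable borel" and fg: "AE x in lebesgue. f x = g x"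
    using lebesgue_complex_AE_borel[OF fm] .
  have [measurable]: "g \<in> borel_measurable lebesgue"
    by (simp add: measurable_completion)
  have "integrable lebesgue g"
    using f by (rule integrable_cong_AE_imp) (use fg in auto)
  then have g: "integrable lborel g"
    by (simp add: integrable_completion)
  have "integrable lebesgue (\<lambda>x. (norm (g x))\<^sup>2)"
    using f2 by (rule integrable_cong_AE_imp) (use fg in auto)
  then have g2: "integrable lborel (\<lambda>x. (norm (g x))\<^sup>2)"
    by (simp add: integrable_completion)
  let ?c = "(2 * pi) powr (- real DIM('a) / 2)"
  have eq: "fourier_integral f = (\<lambda>\<xi>. of_real ?c * raw_fourier g \<xi>)"
  proof
    fix \<xi> :: 'a
    have [measurable]: "(\<lambda>x::'a. cis (- (x \<bullet> \<xi>))) \<in> borel_measurable lebesgue"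
      by (intro measurable_completion) measurable
    have "(LINT x|lebesgue. cis (- (x \<bullet> \<xi>)) * f x) = (LINT x|lebesgue. cis (- (x \<bullet> \<xi>)) * g x)"
      by (rule integral_cong_AE) (use fg in auto)
    also have "\<dots> = raw_fourier g \<xi>"
      unfolding raw_fourier_def by (rule integral_completion) measurable
    finally show "fourier_integral f \<xi> = of_real ?c * raw_fourier g \<xi>"
      unfolding fourier_integral_def by simp
  qed
  show "fourier_integral f \<in> borel_measurable lebesgue"
    unfolding eq using raw_fourier_measurable[OF g] by (intro measurable_completion) simp
  have "L2_energy (fourier_integral f) = (\<integral>\<^sup>+\<xi>. ennreal (?c\<^sup>2 * (norm (raw_fourier g \<xi>))\<^sup>2) \<partial>lborel)"
    unfolding L2_energy_def eq nn_integral_completion by (simp add: norm_mult power_mult_distrib)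
  also have "\<dots> = ennreal (LINT \<xi>|lborel. ?c\<^sup>2 * (norm (raw_fourier g \<xi>))\<^sup>2)"
    using raw_fourier_square_integrable[OF g g2] by (intro nn_integral_eq_integral) auto
  also have "(LINT \<xi>|lborel. ?c\<^sup>2 * (norm (raw_fourier g \<xi>))\<^sup>2) = ?c\<^sup>2 * (2 * pi) powr DIM('a) * (LINT x|lborel. (norm (g x))\<^sup>2)"
    by (simp add: raw_fourier_plancherel[OF g g2])
  also have "?c\<^sup>2 * (2 * pi) powr DIM('a) = 1"
    by (simp add: power2_eq_square flip: powr_add)
  also have "ennreal (1 * (LINT x|lborel. (norm (g x))\<^sup>2)) = (\<integral>\<^sup>+x. ennreal ((norm (g x))\<^sup>2) \<partial>lebesgue)"
    unfolding nn_integral_completion using g2 by (subst nn_integral_eq_integral) auto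
  also have "\<dots> = L2_energy f"
    unfolding L2_energy_def by (rule nn_integral_cong_AE) (use fg in auto)
  finally show "L2_energy (fourier_integral f) = L2_energy f" .
qed

text \<open>Young's inequality for the cross term. With \<delta> = 1 it gives factors 2; letting
  \<delta> tend to 0 recovers the sharp constant in front of the first square.\<close>

lemma norm_add_square_le:
  fixes a b :: "'a::real_normed_vector"
  assumes "0 < \<delta>"
  shows "(norm (a + b))\<^sup>2 \<le> (1 + \<delta>) * (norm a)\<^sup>2 + (1 + 1 / \<delta>) * (norm b)\<^sup>2"
proof -
  have "(norm (a + b))\<^sup>2 \<le> (norm a + norm b)\<^sup>2"
    by (intro power_mono norm_triangle_ineq) auto
  also have "\<dots> \<le> (1 + \<delta>) * (norm a)\<^sup>2 + (1 + 1 / \<delta>) * (norm b)\<^sup>2"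
  proof -
    have "0 \<le> (\<delta> * norm a - norm b)\<^sup>2 / \<delta>" using assms by simp
    also have "\<dots> = \<delta> * (norm a)\<^sup>2 + (1 / \<delta>) * (norm b)\<^sup>2 - 2 * norm a * norm b"
      using assms by (simp add: power2_eq_square field_simps)
    finally show ?thesis by (simp add: power2_sum algebra_simps)
  qed
  finally show ?thesis .
qed

lemma L2_energy_add_le:
  assumes [measurable]: "f \<in> borel_measurable lebesgue" "g \<in> borel_measurable lebesgue" and \<delta>: "0 < \<delta>"
  shows "L2_energy (\<lambda>x. f x + g x) \<le> ennreal (1 + \<delta>) * L2_energy f + ennreal (1 + 1 / \<delta>) * L2_energy g"
proof -
  have "L2_energy (\<lambda>x. f x + g x) \<le>
      (\<integral>\<^sup>+x. ennreal (1 + \<delta>) * ennreal ((norm (f x))\<^sup>2) + ennreal (1 + 1 / \<delta>) * ennreal ((norm (g x))\<^sup>2) \<partial>lebesgue)"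
    unfolding L2_energy_def
  proof (rule nn_integral_mono)
    fix x
    have "ennreal ((norm (f x + g x))\<^sup>2) \<le> ennreal ((1 + \<delta>) * (norm (f x))\<^sup>2 + (1 + 1 / \<delta>) * (norm (g x))\<^sup>2)"
      by (intro ennreal_leI norm_add_square_le \<delta>)
    also have "\<dots> = ennreal (1 + \<delta>) * ennreal ((norm (f x))\<^sup>2) + ennreal (1 + 1 / \<delta>) * ennreal ((norm (g x))\<^sup>2)"
      using \<delta> by (subst ennreal_plus) (auto simp: ennreal_mult')
    finally show "ennreal ((norm (f x + g x))\<^sup>2) \<le> \<dots>" .
  qed
  also have "\<dots> = ennreal (1 + \<delta>) * L2_energy f + ennreal (1 + 1 / \<delta>) * L2_energy g"
    unfolding L2_energy_def by (simp add: nn_integral_add nn_integral_cmult)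
  finally show ?thesis .
qed

lemma L2_energy_minus_commute: "L2_energy (\<lambda>x. f x - g x) = L2_energy (\<lambda>x. g x - f x)"
  by (simp add: L2_energy_def norm_minus_commute)

lemma ennreal_le_if_le_mult:
  fixes a b :: ennreal
  assumes "\<And>\<delta>. 0 < \<delta> \<Longrightarrow> a \<le> ennreal (1 + \<delta>) * b"
  shows "a \<le> b"
proof (rule LIMSEQ_le_const)
  have "(\<lambda>k. 1 + 1 / real (Suc k)) \<longlonglongrightarrow> 1 + 0"
    by (intro tendsto_intros LIMSEQ_Suc lim_1_over_n)
  then have "(\<lambda>k. ennreal (1 + 1 / real (Suc k)) * b) \<longlonglongrightarrow> ennreal (1 + 0) * b"
    by (intro tendsto_mult_ennreal tendsto_ennrealI tendsto_const) auto
  then show "(\<lambda>k. ennreal (1 + 1 / real (Suc k)) * b) \<longlonglongrightarrow> b" by simp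
  show "\<exists>N. \<forall>k\<ge>N. a \<le> ennreal (1 + 1 / real (Suc k)) * b"
    by (intro exI allI impI assms) simp
qed

text \<open>Continuity of the squared norm, obtained without square roots of extended reals: in each
  direction apply \<open>L2_energy_add_le\<close>, let k tend to infinity with \<delta> fixed, and
  only then remove the factor 1 + \<delta>.\<close>

lemma L2_energy_tendsto:
  fixes a :: "nat \<Rightarrow> 'a::euclidean_space \<Rightarrow> complex"
  assumes [measurable]: "\<And>k. a k \<in> borel_measurable lebesgue" "g \<in> borel_measurable lebesgue"
    and diff: "(\<lambda>k. L2_energy (\<lambda>x. a k x - g x)) \<longlonglongrightarrow> 0" and A: "(\<lambda>k. L2_energy (a k)) \<longlonglongrightarrow> A"
  shows "L2_energy g = A"
proof (rule antisym)
  show "L2_energy g \<le> A"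
  proof (rule ennreal_le_if_le_mult)
    fix \<delta> :: real assume \<delta>: "0 < \<delta>"
    have "(\<lambda>k. ennreal (1 + \<delta>) * L2_energy (a k) + ennreal (1 + 1 / \<delta>) * L2_energy (\<lambda>x. a k x - g x)) \<longlonglongrightarrow>
      ennreal (1 + \<delta>) * A + ennreal (1 + 1 / \<delta>) * 0"
      by (intro tendsto_add ennreal_tendsto_cmult diff A) auto
    moreover have "L2_energy g \<le> ennreal (1 + \<delta>) * L2_energy (a k) + ennreal (1 + 1 / \<delta>) * L2_energy (\<lambda>x. a k x - g x)" for k
      using L2_energy_add_le[of "a k" "\<lambda>x. g x - a k x" \<delta>] \<delta>
      by (simp add: L2_energy_minus_commute[of "a k" g])
    ultimately show "L2_energy g \<le> ennreal (1 + \<delta>) * A"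
      by (intro LIMSEQ_le_const) auto
  qed
  show "A \<le> L2_energy g"
  proof (rule ennreal_le_if_le_mult)
    fix \<delta> :: real assume \<delta>: "0 < \<delta>"
    have "(\<lambda>k. ennreal (1 + \<delta>) * L2_energy g + ennreal (1 + 1 / \<delta>) * L2_energy (\<lambda>x. a k x - g x)) \<longlonglongrightarrow>
      ennreal (1 + \<delta>) * L2_energy g + ennreal (1 + 1 / \<delta>) * 0"
      by (intro tendsto_add ennreal_tendsto_cmult diff tendsto_const) auto
    moreover have "L2_energy (a k) \<le> ennreal (1 + \<delta>) * L2_energy g + ennreal (1 + 1 / \<delta>) * L2_energy (\<lambda>x. a k x - g x)" for k
      using L2_energy_add_le[of g "\<lambda>x. a k x - g x" \<delta>] \<delta> by simp
    ultimately show "A \<le> ennreal (1 + \<delta>) * L2_energy g"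
      using A by (auto intro: LIMSEQ_le)
  qed
qed

lemma L2_energy_eq: "f \<in> L2 \<Longrightarrow> L2_energy f = ennreal ((L2_norm f)\<^sup>2)"
  unfolding L2_energy_def L2_def L2_norm_def by (subst nn_integral_eq_integral) auto

lemma L2_norm_nonneg: "0 \<le> L2_norm f"
  by (simp add: L2_norm_def)

lemma L2_norm_square: "(L2_norm f)\<^sup>2 = (LINT x|lebesgue. (norm (f x))\<^sup>2)"
  by (simp add: L2_norm_def)

text \<open>Balls have finite measure and |f| \<le> 1 + |f|^2, so truncations lie in both L1 and L2,
  where Plancherel is already available; their energies increase to that of
  \<open>f\<close>.\<close>

lemma
  fixes f :: "'a::euclidean_space \<Rightarrow> complex"
  assumes "f \<in> L2"
  shows truncation_integrable: "integrable lebesgue (\<lambda>x. indicator (cball 0 R) x * f x)"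
    and truncation_square_integrable: "integrable lebesgue (\<lambda>x. (norm (indicator (cball 0 R) x * f x))\<^sup>2)"
    and truncation_energy:
      "(\<lambda>k. L2_energy (\<lambda>x. indicator (cball 0 (real k)) x * f x)) \<longlonglongrightarrow> L2_energy f"
proof -
  have [measurable]: "f \<in> borel_measurable lebesgue" and f2: "integrable lebesgue (\<lambda>x. (norm (f x))\<^sup>2)"
    using assms by (auto simp: L2_def)
  have [measurable]: "cball 0 r \<in> sets (lebesgue :: 'a measure)" for r
    by simp
  have ind: "integrable lebesgue (indicator (cball 0 R) :: 'a \<Rightarrow> real)"
    using lmeasurable_cball[of 0 R] by (auto simp: fmeasurable_def intro!: integrable_real_indicator)
  show "integrable lebesgue (\<lambda>x. indicator (cball 0 R) x * f x)"
  proof (rule Bochner_Integration.integrable_bound)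
    show "integrable lebesgue (\<lambda>x. indicator (cball 0 R) x + (norm (f x))\<^sup>2)"
      using ind f2 by simp
    have "y \<le> 1 + y\<^sup>2" for y :: real
      using zero_le_power2[of "y - 1 / 2"] by (simp add: power2_eq_square algebra_simps)
    then show "AE x in lebesgue. norm (indicator (cball 0 R) x * f x) \<le> norm (indicator (cball 0 R) x + (norm (f x))\<^sup>2)"
      by (intro AE_I2) (auto simp: indicator_def)
  qed measurable
  show "integrable lebesgue (\<lambda>x. (norm (indicator (cball 0 R) x * f x))\<^sup>2)"
  proof (rule Bochner_Integration.integrable_bound[OF f2])
    show "AE x in lebesgue. norm ((norm (indicator (cball 0 R) x * f x))\<^sup>2) \<le> norm ((norm (f x))\<^sup>2)"
      by (intro AE_I2) (auto simp: indicator_def)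
  qed measurable
  show "(\<lambda>k. L2_energy (\<lambda>x. indicator (cball 0 (real k)) x * f x)) \<longlonglongrightarrow> L2_energy f"
    unfolding L2_energy_def
  proof (rule nn_integral_LIMSEQ)
    show "incseq (\<lambda>k x. ennreal ((norm (indicator (cball 0 (real k)) x * f x))\<^sup>2))"
      by (auto simp: incseq_def le_fun_def indicator_def)
    fix x :: 'a
    obtain K :: nat where "norm x \<le> real K" using real_arch_simple by blast
    then have "ennreal ((norm (indicator (cball 0 (real k)) x * f x))\<^sup>2) = ennreal ((norm (f x))\<^sup>2)" if "k \<ge> K" for k
      using that by (auto simp: indicator_def)
    then show "(\<lambda>k. ennreal ((norm (indicator (cball 0 (real k)) x * f x))\<^sup>2)) \<longlonglongrightarrow> ennreal ((norm (f x))\<^sup>2)"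
      by (intro tendsto_eventually) (auto simp: eventually_sequentially)
  qed measurable
qed

lemma has_L2_fourier_sequence:
  assumes "has_L2_fourier f g"
  shows "(\<lambda>k. L2_energy (\<lambda>\<xi>. fourier_integral (\<lambda>x. indicator (cball 0 (real k)) x * f x) \<xi> - g \<xi>)) \<longlonglongrightarrow> 0"
  using assms filterlim_compose[OF _ filterlim_real_sequentially]
  unfolding has_L2_fourier_def L2_energy_def by blast

text \<open>Each truncation has the same energy as its Fourier integral. These energies converge to
  that of \<open>f\<close> by monotone convergence and to that of \<open>g\<close> by L2
  convergence.\<close>

lemma has_L2_fourier_plancherel:
  assumes fg: "has_L2_fourier f g"
  shows "L2_norm g = L2_norm f"
proof -
  have f: "f \<in> L2" and g: "g \<in> L2" using fg by (auto simp: has_L2_fourier_def)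
  let ?f = "\<lambda>k x. indicator (cball 0 (real k)) x * f x"
  have "L2_energy g = L2_energy f"
  proof (rule L2_energy_tendsto)
    show "fourier_integral (?f k) \<in> borel_measurable lebesgue" for k
      by (intro fourier_integral_measurable truncation_integrable truncation_square_integrable f)
    show "g \<in> borel_measurable lebesgue" using g by (simp add: L2_def)
    show "(\<lambda>k. L2_energy (\<lambda>\<xi>. fourier_integral (?f k) \<xi> - g \<xi>)) \<longlonglongrightarrow> 0"
      by (rule has_L2_fourier_sequence[OF fg])
    show "(\<lambda>k. L2_energy (fourier_integral (?f k))) \<longlonglongrightarrow> L2_energy f"
      using truncation_energy[OF f]
      by (subst fourier_integral_plancherel) (intro truncation_integrable truncation_square_integrable f)+
  qed
  then show ?thesis
    using f g by (simp add: L2_energy_eq L2_norm_nonneg)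
qed

text \<open>Uniqueness of L2 limits. It reconciles the transform of \<open>u1\<close> named in the
  theorem with the one chosen inside \<open>wave_solution\<close>.\<close>

lemma has_L2_fourier_unique:
  assumes fg: "has_L2_fourier f g" and fh: "has_L2_fourier f h"
  shows "AE \<xi> in lebesgue. g \<xi> = h \<xi>"
proof -
  have f: "f \<in> L2" and [measurable]: "g \<in> borel_measurable lebesgue" "h \<in> borel_measurable lebesgue"
    using fg fh by (auto simp: has_L2_fourier_def L2_def)
  define a where "a k = fourier_integral (\<lambda>x. indicator (cball 0 (real k)) x * f x)" for k
  have [measurable]: "a k \<in> borel_measurable lebesgue" for k
    unfolding a_def by (intro fourier_integral_measurable truncation_integrable truncation_square_integrable f)
  have le: "L2_energy (\<lambda>\<xi>. g \<xi> - h \<xi>) \<le> ennreal 2 * L2_energy (\<lambda>\<xi>. a k \<xi> - g \<xi>) + ennreal 2 * L2_energy (\<lambda>\<xi>. a k \<xi> - h \<xi>)" for k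
    using L2_energy_add_le[of "\<lambda>\<xi>. g \<xi> - a k \<xi>" "\<lambda>\<xi>. a k \<xi> - h \<xi>" 1]
    by (simp add: L2_energy_minus_commute[of "a k" g])
  have "(\<lambda>k. ennreal 2 * L2_energy (\<lambda>\<xi>. a k \<xi> - g \<xi>) + ennreal 2 * L2_energy (\<lambda>\<xi>. a k \<xi> - h \<xi>)) \<longlonglongrightarrow> ennreal 2 * 0 + ennreal 2 * 0"
    unfolding a_def by (intro tendsto_add ennreal_tendsto_cmult has_L2_fourier_sequence fg fh) auto
  then have "L2_energy (\<lambda>\<xi>. g \<xi> - h \<xi>) \<le> ennreal 2 * 0 + ennreal 2 * 0"
    by (rule LIMSEQ_le_const) (use le in auto)
  then have "(\<integral>\<^sup>+\<xi>. ennreal ((norm (g \<xi> - h \<xi>))\<^sup>2) \<partial>lebesgue) = 0"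
    by (simp add: L2_energy_def)
  then show ?thesis
    by (subst (asm) nn_integral_0_iff_AE) auto
qed

section \<open>The wave equation\<close>

text \<open>The Taylor remainder of order three gives |sin x - x| \<le> x^3/6 \<le> x/6 on the unit
  interval.\<close>

lemma half_le_sin:
  fixes x :: real
  assumes "0 \<le> x" "x \<le> 1"
  shows "x / 2 \<le> sin x"
proof -
  have "\<bar>sin x - (\<Sum>m<3. sin_coeff m * x ^ m)\<bar> \<le> inverse (fact 3) * \<bar>x\<bar> ^ 3"
    by (rule Maclaurin_sin_bound)
  moreover have "(\<Sum>m<3. sin_coeff m * x ^ m) = x"
    by (simp add: eval_nat_numeral sin_coeff_def)
  moreover have "x ^ 3 \<le> x"
    using assms power_decreasing[of 1 3 x] by simp
  ultimately have "6 * \<bar>sin x - x\<bar> \<le> x"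
    using assms by (simp add: fact_numeral)
  then show ?thesis using abs_ge_minus_self[of "sin x - x"] assms by (simp add: algebra_simps)
qed

lemma wave_hat_norm_square_le:
  assumes "t \<ge> 0"
  shows "(norm (wave_hat v0 v1 t \<xi>))\<^sup>2 \<le> 2 * (norm (v0 \<xi>))\<^sup>2 + 2 * t\<^sup>2 * (norm (v1 \<xi>))\<^sup>2"
proof -
  let ?a = "of_real (cos (norm \<xi> * t)) * v0 \<xi>" and ?b = "of_real (sin (norm \<xi> * t) / norm \<xi>) * v1 \<xi>"
  have "(norm (?a + ?b))\<^sup>2 \<le> (1 + 1) * (norm ?a)\<^sup>2 + (1 + 1 / 1) * (norm ?b)\<^sup>2"
    by (rule norm_add_square_le) simp
  moreover have "(norm ?a)\<^sup>2 \<le> (norm (v0 \<xi>))\<^sup>2"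
    by (auto intro!: power_mono mult_left_le_one_le simp: norm_mult)
  moreover have "(norm ?b)\<^sup>2 \<le> (t * norm (v1 \<xi>))\<^sup>2"
  proof -
    have "\<bar>sin (norm \<xi> * t)\<bar> \<le> norm \<xi> * t"
      using abs_sin_x_le_abs_x[of "norm \<xi> * t"] assms by simp
    \<comment> \<open>At \<xi> = 0 the quotient is 0 by the convention for division, so the bound
      holds there as well.\<close>
    then have "\<bar>sin (norm \<xi> * t) / norm \<xi>\<bar> \<le> t"
      using assms by (cases "\<xi> = 0") (auto simp: field_simps)
    then show ?thesis
      unfolding norm_mult norm_of_real by (intro power_mono mult_right_mono) auto
  qed
  ultimately show ?thesis
    unfolding wave_hat_def power_mult_distrib by (simp only: ring_distribs)
qed

text \<open>Where |\<xi>| t \<le> 1 the sine multiplier is at least t/2. Moving the cosine term to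
  the other side isolates the velocity term; the factors 2 come from
  \<open>norm_add_square_le\<close> with \<delta> = 1.\<close>

lemma wave_hat_norm_square_ge:
  fixes \<xi> :: "'a::euclidean_space"
  assumes t: "t > 0" and \<xi>: "\<xi> \<noteq> 0" "norm \<xi> \<le> 1 / t"
  shows "(t / 2 * norm (v1 \<xi>))\<^sup>2 \<le> 2 * (norm (wave_hat v0 v1 t \<xi>))\<^sup>2 + 2 * (norm (v0 \<xi>))\<^sup>2"
proof -
  let ?a = "of_real (cos (norm \<xi> * t)) * v0 \<xi>" and ?b = "of_real (sin (norm \<xi> * t) / norm \<xi>) * v1 \<xi>"
  have "norm \<xi> * t / 2 \<le> sin (norm \<xi> * t)"
    using t \<xi> by (intro half_le_sin) (auto simp: field_simps)
  then have "t / 2 \<le> sin (norm \<xi> * t) / norm \<xi>"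
    using \<xi> by (simp add: field_simps)
  then have "t / 2 \<le> \<bar>sin (norm \<xi> * t) / norm \<xi>\<bar>" by linarith
  then have "(t / 2 * norm (v1 \<xi>))\<^sup>2 \<le> (norm ?b)\<^sup>2"
    unfolding norm_mult norm_of_real using t by (intro power_mono mult_right_mono) auto
  also have "?b = wave_hat v0 v1 t \<xi> + - ?a"
    by (simp add: wave_hat_def)
  also have "(norm (wave_hat v0 v1 t \<xi> + - ?a))\<^sup>2 \<le>
      (1 + 1) * (norm (wave_hat v0 v1 t \<xi>))\<^sup>2 + (1 + 1 / 1) * (norm (- ?a))\<^sup>2"
    by (rule norm_add_square_le) simp
  also have "(norm (- ?a))\<^sup>2 \<le> (norm (v0 \<xi>))\<^sup>2"
    by (auto intro!: power_mono mult_left_le_one_le simp: norm_mult)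
  finally show ?thesis by simp
qed

section \<open>L2 bounds for the solution in frequency space\<close>

lemma wave_hat_L2_upper:
  assumes "v0 \<in> L2" "v1 \<in> L2" "wave_hat v0 v1 t \<in> L2" "t \<ge> 1"
  shows "L2_norm (wave_hat v0 v1 t) \<le> 2 * t * (L2_norm v0 + L2_norm v1)"
proof (rule power2_le_imp_le)
  have "(L2_norm (wave_hat v0 v1 t))\<^sup>2 \<le>
      (LINT \<xi>|lebesgue. 2 * (norm (v0 \<xi>))\<^sup>2 + 2 * t\<^sup>2 * (norm (v1 \<xi>))\<^sup>2)"
    unfolding L2_norm_square using assms
    by (intro integral_mono wave_hat_norm_square_le) (auto simp: L2_def)
  also have "\<dots> = 2 * (L2_norm v0)\<^sup>2 + 2 * t\<^sup>2 * (L2_norm v1)\<^sup>2"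
    unfolding L2_norm_square using assms by (simp add: L2_def)
  \<comment> \<open>Here t \<ge> 1 lets the bounded contribution of \<open>v0\<close> be absorbed
    into the growth rate t^2.\<close>
  also have "\<dots> \<le> 2 * t\<^sup>2 * (L2_norm v0)\<^sup>2 + 2 * t\<^sup>2 * (L2_norm v1)\<^sup>2"
    using assms(4) by (intro add_mono mult_right_mono) (auto simp: one_le_power)
  also have "\<dots> \<le> 2 * t\<^sup>2 * (L2_norm v0 + L2_norm v1)\<^sup>2"
    using L2_norm_nonneg[of v0] L2_norm_nonneg[of v1] by (simp add: power2_sum algebra_simps)
  also have "\<dots> \<le> (2 * t * (L2_norm v0 + L2_norm v1))\<^sup>2"
    by (simp add: power_mult_distrib mult_right_mono)
  finally show "(L2_norm (wave_hat v0 v1 t))\<^sup>2 \<le> (2 * t * (L2_norm v0 + L2_norm v1))\<^sup>2" .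
qed (use assms(4) L2_norm_nonneg[of v0] L2_norm_nonneg[of v1] in auto)

text \<open>Integrate the pointwise lower bound over the ball of radius 1/t: the squared multiplier
  contributes t^2, the datum t^(n - \<epsilon>), and the volume t^(-n).\<close>

lemma wave_hat_L2_lower:
  fixes v0 v1 :: "'a::euclidean_space \<Rightarrow> complex" and \<epsilon> :: real
  assumes L2: "v0 \<in> L2" "v1 \<in> L2" "wave_hat v0 v1 t \<in> L2" and t: "t \<ge> 1" and c0: "0 < c0"
    and \<epsilon>: "\<epsilon> \<le> DIM('a)"
    and v1: "AE \<xi> in lebesgue. 0 < norm \<xi> \<and> norm \<xi> \<le> 1 \<longrightarrow>
      norm (v1 \<xi>) \<ge> c0 * norm \<xi> powr (- real DIM('a) / 2 + \<epsilon> / 2)"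
  shows "c0\<^sup>2 * measure lborel (cball (0::'a) 1) / 8 * t powr (2 - \<epsilon>) \<le>
    (L2_norm (wave_hat v0 v1 t))\<^sup>2 + (L2_norm v0)\<^sup>2"
proof -
  let ?n = "real DIM('a)" and ?B = "cball (0::'a) (1 / t)"
  let ?m = "(t / 2 * (c0 * t powr (?n / 2 - \<epsilon> / 2)))\<^sup>2"
  have B: "integrable lebesgue (indicator ?B :: 'a \<Rightarrow> real)"
    using lmeasurable_cball[of 0 "1 / t"] by (auto simp: fmeasurable_def intro!: integrable_real_indicator)
  have "(LINT \<xi>|lebesgue. ?m * indicator ?B \<xi>) \<le>
      (LINT \<xi>|lebesgue. 2 * (norm (wave_hat v0 v1 t \<xi>))\<^sup>2 + 2 * (norm (v0 \<xi>))\<^sup>2)"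
  proof (rule integral_mono_AE)
    have "AE \<xi> in lebesgue. \<xi> \<noteq> (0::'a)"
      by (intro AE_completion AE_lborel_singleton)
    with v1 show "AE \<xi> in lebesgue. ?m * indicator ?B \<xi> \<le>
      2 * (norm (wave_hat v0 v1 t \<xi>))\<^sup>2 + 2 * (norm (v0 \<xi>))\<^sup>2"
    proof eventually_elim
      case (elim \<xi>)
      show ?case
      proof (cases "\<xi> \<in> ?B")
        case True
        then have r: "norm \<xi> \<le> 1 / t" by simp
        also have "1 / t \<le> 1" using t by simp
        finally have "c0 * norm \<xi> powr (- ?n / 2 + \<epsilon> / 2) \<le> norm (v1 \<xi>)"
          using elim by simp
        \<comment> \<open>The exponent -n/2 + \<epsilon>/2 is nonpositive because \<epsilon> \<le>
          n, so on the punctured ball the power is smallest at radius 1/t.\<close>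
        moreover have "t powr (?n / 2 - \<epsilon> / 2) \<le> norm \<xi> powr (- ?n / 2 + \<epsilon> / 2)"
        proof -
          have "t powr y = (1 / t) powr - y" for y
            using t by (simp add: powr_divide powr_minus)
          then have "t powr (?n / 2 - \<epsilon> / 2) = (1 / t) powr - (?n / 2 - \<epsilon> / 2)" .
          also have "- (?n / 2 - \<epsilon> / 2) = - ?n / 2 + \<epsilon> / 2" by simp
          also have "(1 / t) powr \<dots> \<le> norm \<xi> powr (- ?n / 2 + \<epsilon> / 2)"
            using r elim \<epsilon> by (intro powr_mono2') auto
          finally show ?thesis .
        qed
        ultimately have "c0 * t powr (?n / 2 - \<epsilon> / 2) \<le> norm (v1 \<xi>)"
          using c0 by (meson mult_left_mono less_imp_le order_trans)
        then have "?m \<le> (t / 2 * norm (v1 \<xi>))\<^sup>2"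
          using t c0 by (intro power_mono mult_left_mono) auto
        also have "\<dots> \<le> 2 * (norm (wave_hat v0 v1 t \<xi>))\<^sup>2 + 2 * (norm (v0 \<xi>))\<^sup>2"
          using t r elim by (intro wave_hat_norm_square_ge) auto
        finally show ?thesis using True by simp
      qed simp
    qed
  qed (use B L2 in \<open>auto simp: L2_def\<close>)
  also have "\<dots> = 2 * (L2_norm (wave_hat v0 v1 t))\<^sup>2 + 2 * (L2_norm v0)\<^sup>2"
    unfolding L2_norm_square using L2 by (simp add: L2_def)
  also have "(LINT \<xi>|lebesgue. ?m * indicator ?B \<xi>) = ?m * measure lborel ?B"
    by simp
  also have "measure lborel ?B = measure lborel (cball (0::'a) 1) * t powr (- ?n)"
    using t by (simp add: content_cball powr_minus powr_realpow power_divide field_simps)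
  \<comment> \<open>The 8 is the 4 from squaring t/2 times the common factor 2 on the right-hand
    side, which is about to be cancelled.\<close>
  also have "?m * (measure lborel (cball (0::'a) 1) * t powr (- ?n)) =
     2 * (c0\<^sup>2 * measure lborel (cball (0::'a) 1) / 8 * t powr (2 - \<epsilon>))"
  proof -
    have "t\<^sup>2 * (t powr (?n / 2 - \<epsilon> / 2))\<^sup>2 * t powr (- ?n) = t powr (2 - \<epsilon>)"
    proof -
      have "t\<^sup>2 = t powr 2" using t by simp
      then show ?thesis by (simp add: power2_eq_square[of "t powr _"] flip: powr_add)
    qed
    then show ?thesis by (simp add: power_mult_distrib power_divide mult_ac)
  qed
  finally show ?thesis by simp
qed

theorem theorem2p2:
  "\<exists>\<epsilon>0>0. \<forall>\<epsilon>. 0 < \<epsilon> \<and> \<epsilon> < \<epsilon>0 \<longrightarrow>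
     (\<exists>C>0. \<forall>(u0 :: real ^ 'n \<Rightarrow> complex) u1 u1_hat c0 u.
        u0 \<in> L2 \<and> u1 \<in> L2 \<and> has_L2_fourier u1 u1_hat \<and> 0 < c0 \<and>
        (AE \<xi> in lebesgue. 0 < norm \<xi> \<and> norm \<xi> \<le> 1 \<longrightarrow>
           norm (u1_hat \<xi>) \<ge> c0 * norm \<xi> powr (- real CARD('n) / 2 + \<epsilon> / 2)) \<and>
        wave_solution u0 u1 u
        \<longrightarrow> (\<exists>c>0. \<exists>T>0. \<forall>t\<ge>T.
               c * t powr (1 - \<epsilon> / 2) \<le> L2_norm (u t) \<and>
               L2_norm (u t) \<le> C * t * (L2_norm u0 + L2_norm u1)))"
proof (rule exI[of _ 1], intro conjI allI impI)
  \<comment> \<open>The threshold 1 serves twice: it gives \<epsilon> \<le> n for every dimension,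
    and 2 - \<epsilon> \<ge> 1, so that t^(2 - \<epsilon>) dominates t. The constant C = 2 is that
    of \<open>wave_hat_L2_upper\<close>.\<close>
  fix \<epsilon> :: real assume \<epsilon>: "0 < \<epsilon> \<and> \<epsilon> < 1"
  show "\<exists>C>0. \<forall>(u0 :: real ^ 'n \<Rightarrow> complex) u1 u1_hat c0 u.
        u0 \<in> L2 \<and> u1 \<in> L2 \<and> has_L2_fourier u1 u1_hat \<and> 0 < c0 \<and>
        (AE \<xi> in lebesgue. 0 < norm \<xi> \<and> norm \<xi> \<le> 1 \<longrightarrow>
           norm (u1_hat \<xi>) \<ge> c0 * norm \<xi> powr (- real CARD('n) / 2 + \<epsilon> / 2)) \<and>
        wave_solution u0 u1 u
        \<longrightarrow> (\<exists>c>0. \<exists>T>0. \<forall>t\<ge>T.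
               c * t powr (1 - \<epsilon> / 2) \<le> L2_norm (u t) \<and>
               L2_norm (u t) \<le> C * t * (L2_norm u0 + L2_norm u1))"
  proof (rule exI[of _ 2], intro conjI allI impI; (elim conjE)?)
    fix u0 u1 u1_hat :: "real ^ 'n \<Rightarrow> complex" and c0 :: real and u
    assume u1_hat: "has_L2_fourier u1 u1_hat" and c0: "0 < c0" and "wave_solution u0 u1 u"
      and lower: "AE \<xi> in lebesgue. 0 < norm \<xi> \<and> norm \<xi> \<le> 1 \<longrightarrow>
           norm (u1_hat \<xi>) \<ge> c0 * norm \<xi> powr (- real CARD('n) / 2 + \<epsilon> / 2)"
    then obtain v0 v1 where v0: "has_L2_fourier u0 v0" and v1: "has_L2_fourier u1 v1"
      and u: "\<And>t. t \<ge> 0 \<Longrightarrow> has_L2_fourier (u t) (wave_hat v0 v1 t)"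
      unfolding wave_solution_def by blast
    have L2: "v0 \<in> L2" "v1 \<in> L2" using v0 v1 by (auto simp: has_L2_fourier_def)
    \<comment> \<open>The frequency bound is assumed for \<open>u1_hat\<close>; almost everywhere
      uniqueness transfers it to the transform \<open>v1\<close> from which the solution is
      built.\<close>
    have v1_lower: "AE \<xi> in lebesgue. 0 < norm \<xi> \<and> norm \<xi> \<le> 1 \<longrightarrow>
        norm (v1 \<xi>) \<ge> c0 * norm \<xi> powr (- real DIM(real ^ 'n) / 2 + \<epsilon> / 2)"
      using lower has_L2_fourier_unique[OF u1_hat v1] by eventually_elim simp
    define K where "K = c0\<^sup>2 * measure lborel (cball (0 :: real ^ 'n) 1) / 8"
    have K: "K > 0"
      unfolding K_def using c0 by simp
    \<comment> \<open>Beyond this time the squared norm of \<open>u0\<close> is at most K t / 2,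
      hence at most half of the main term K t^(2 - \<epsilon>). The other half survives, which
      explains the constant \<open>sqrt (K / 2)\<close>; the maximum with 1 secures t \<ge>
      1.\<close>
    define T where "T = max 1 (2 * (L2_norm u0)\<^sup>2 / K)"
    have "sqrt (K / 2) * t powr (1 - \<epsilon> / 2) \<le> L2_norm (u t) \<and>
        L2_norm (u t) \<le> 2 * t * (L2_norm u0 + L2_norm u1)" if tT: "t \<ge> T" for t
    proof
      from tT have t: "t \<ge> 1" by (simp add: T_def)
      then have w: "wave_hat v0 v1 t \<in> L2" using u[of t] by (auto simp: has_L2_fourier_def)
      have norms: "L2_norm (u t) = L2_norm (wave_hat v0 v1 t)" "L2_norm u0 = L2_norm v0" "L2_norm u1 = L2_norm v1"
        using t by (auto simp: has_L2_fourier_plancherel[OF u] has_L2_fourier_plancherel[OF v0] has_L2_fourier_plancherel[OF v1])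
      show "L2_norm (u t) \<le> 2 * t * (L2_norm u0 + L2_norm u1)"
        unfolding norms by (rule wave_hat_L2_upper[OF L2 w t])
      show "sqrt (K / 2) * t powr (1 - \<epsilon> / 2) \<le> L2_norm (u t)"
      proof (rule power2_le_imp_le)
        have "2 * (L2_norm u0)\<^sup>2 / K \<le> t"
          using tT by (simp add: T_def)
        then have "(L2_norm u0)\<^sup>2 \<le> K / 2 * t"
          using K by (simp add: field_simps)
        also have "\<dots> \<le> K / 2 * t powr (2 - \<epsilon>)"
          using K t \<epsilon> powr_mono[of 1 "2 - \<epsilon>" t] by (intro mult_left_mono) auto
        finally have "(L2_norm u0)\<^sup>2 \<le> K / 2 * t powr (2 - \<epsilon>)" .
        moreover have "K * t powr (2 - \<epsilon>) \<le> (L2_norm (u t))\<^sup>2 + (L2_norm u0)\<^sup>2"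
        proof -
          have "\<epsilon> \<le> real DIM(real ^ 'n)"
            using \<epsilon> DIM_positive[where 'a = "real ^ 'n"] by linarith
          then show ?thesis
            unfolding norms K_def by (rule wave_hat_L2_lower[OF L2 w t c0 _ v1_lower])
        qed
        ultimately have "K / 2 * t powr (2 - \<epsilon>) \<le> (L2_norm (u t))\<^sup>2"
          by linarith
        moreover have "(t powr (1 - \<epsilon> / 2))\<^sup>2 = t powr (2 - \<epsilon>)"
          by (simp add: power2_eq_square flip: powr_add)
        ultimately show "(sqrt (K / 2) * t powr (1 - \<epsilon> / 2))\<^sup>2 \<le> (L2_norm (u t))\<^sup>2"
          using K by (simp add: power_mult_distrib)
      qed (rule L2_norm_nonneg)
    qed
    moreover have "0 < sqrt (K / 2)" "0 < T"
      using K by (auto simp: T_def)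
    ultimately show "\<exists>c>0. \<exists>T>0. \<forall>t\<ge>T. c * t powr (1 - \<epsilon> / 2) \<le> L2_norm (u t) \<and>
        L2_norm (u t) \<le> 2 * t * (L2_norm u0 + L2_norm u1)"
      by blast
  qed simp
qed simp

end
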